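(* Let $\mathfrak{A}$ be a unital C*-algebra, $\mathfrak{H}$ a Hilbert $\mathfrak{A}$-module and $(\mathfrak{H}_n)_{n\in\mathbb{N}^*}$ a sequence of orthogonally complemented submodules of $\mathfrak{H}$. For every $(\alpha_n)_{n\in\mathbb{N}^*},(\beta_n)_{n\in\mathbb{N}^*}\in\mathfrak{m}((\mathfrak{H}_n)_{n\in\mathbb{N}^*})$, the sequence $(\alpha_n+\beta_n)_{n\in\mathbb{N}^*}$ belongs to $\mathfrak{m}((\mathfrak{H}_n)_{n\in\mathbb{N}^*})$. It follows that $\mathfrak{m}((\mathfrak{H}_n)_{n\in\mathbb{N}^*})$, whenever it is nonempty, is a convex cone of the $\mathbb{C}$-vector space $\mathfrak{A}^{\mathbb{N}^*}$.
   Context: $\mathbb{N}^*=\{1,2,3,\dots\}$; $\mathfrak{A}^{\mathbb{N}^*}$ is the space of all sequences in $\mathfrak{A}$. Hilbert $\mathfrak{A}$-modules are left modules with $\mathfrak{A}$-valued inner product $\langle\cdot,\cdot\rangle$ that is $\mathfrak{A}$-linear in the first variable; $|x|:=\langle x,x\rangle^{1/2}\in\mathfrak{A}$ and $\|x\|_{\mathfrak{H}}:=\||x|\|_{\mathfrak{A}}$. For $a,b\in\mathfrak{A}$, $a\preccurlyeq b$ means that $b-a$ is positive. An element of $\mathfrak{A}$ is strictly positive if every nonzero positive linear form takes a value $>0$ on it; since $\mathfrak{A}$ is unital this is equivalent to being positive and invertible. A closed submodule $\mathfrak{K}$ of $\mathfrak{H}$ is orthogonally complemented if $\mathfrak{H}=\mathfrak{K}\oplus\mathfrak{K}^\perp$,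 where $\mathfrak{K}^\perp=\{u\in\mathfrak{H}:\langle u,x\rangle=0\ \forall x\in\mathfrak{K}\}$; $P_{\mathfrak{K}}$ denotes the corresponding orthogonal projection of $\mathfrak{H}$ onto $\mathfrak{K}$. A weight of $\mathfrak{A}$ is a sequence $(\omega_n)_{n\in\mathbb{N}^*}$ of central and strictly positive elements of $\mathfrak{A}$. Given a weight $(\omega_n)_{n\in\mathbb{N}^*}$ of $\mathfrak{A}$, the sequence $((\mathfrak{H}_n,\omega_n))_{n\in\mathbb{N}^*}$ is a *-fusion frame of $\mathfrak{H}$ if for each $x\in\mathfrak{H}$ the series $\sum\omega_n^2|P_{\mathfrak{H}_n}(x)|^2$ converges in the norm of $\mathfrak{A}$ and there exist two strictly positive elements $A,B$ of $\mathfrak{A}$ such that $|Ax|^2\preccurlyeq\sum_{n=1}^{+\infty}\omega_n^2|P_{\mathfrak{H}_n}(x)|^2\preccurlyeq|Bx|^2$ for all $x\in\mathfrak{H}$. $\mathfrak{m}((\mathfrak{H}_n)_{n\in\mathbb{N}^*})$ denotes the set of all weights $(\omega_n)_{n\in\mathbb{N}^*}$ of $\mathfrak{A}$ such that $((\mathfrak{H}_n,\omega_n))_{n\in\mathbb{N}^*}$ is a *-fusion frame of $\mathfrak{H}$. A nonempty subset $W$ of a complex vector space is a convex cone if for all $x,y\in W$ and every real $\lambda>0$ one has $x+y\in W$ and $\lambda x\in W$. *)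

theory Defs
  imports "HOL-Analysis.Analysis" "HOL-Library.Function_Algebras"
begin

(* Unital complex C*-algebras. The unit comes from monoid_mult rather than ring_1, so the
   zero algebra is allowed; the norm of 1 is 1 in every other instance by the C*-identity. *)
class unital_cstar_algebra = real_normed_algebra + banach + monoid_mult +
  fixes scaleC :: "complex \<Rightarrow> 'a \<Rightarrow> 'a" (infixr "*\<^sub>C" 75)
    and star :: "'a \<Rightarrow> 'a"
  assumes scaleC_add_right: "c *\<^sub>C (a + b) = c *\<^sub>C a + c *\<^sub>C b"
    and scaleC_add_left: "(c + d) *\<^sub>C a = c *\<^sub>C a + d *\<^sub>C a"
    and scaleC_scaleC: "c *\<^sub>C d *\<^sub>C a = (c * d) *\<^sub>C a"
    and scaleC_one: "1 *\<^sub>C a = a"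
    and scaleR_scaleC: "r *\<^sub>R a = complex_of_real r *\<^sub>C a"
    and mult_scaleC_left: "(c *\<^sub>C a) * b = c *\<^sub>C (a * b)"
    and mult_scaleC_right: "a * (c *\<^sub>C b) = c *\<^sub>C (a * b)"
    and norm_scaleC: "norm (c *\<^sub>C a) = cmod c * norm a"
    and star_add: "star (a + b) = star a + star b"
    and star_scaleC: "star (c *\<^sub>C a) = cnj c *\<^sub>C star a"
    and star_mult: "star (a * b) = star b * star a"
    and star_star: "star (star a) = a"
    and cstar_identity: "norm (star a * a) = (norm a)\<^sup>2"

definition cstar_positive :: "'a::unital_cstar_algebra \<Rightarrow> bool"
  where "cstar_positive a \<longleftrightarrow> (\<exists>b. a = star b * b)"

definition cstar_le :: "'a::unital_cstar_algebra \<Rightarrow> 'a \<Rightarrow> bool" (infix "\<preceq>" 50)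
  where "a \<preceq> b \<longleftrightarrow> cstar_positive (b - a)"

definition positive_sqrt :: "'a::unital_cstar_algebra \<Rightarrow> 'a"
  where "positive_sqrt a = (THE b. cstar_positive b \<and> b\<^sup>2 = a)"

definition positive_linear_form :: "('a::unital_cstar_algebra \<Rightarrow> complex) \<Rightarrow> bool"
  where "positive_linear_form f \<longleftrightarrow>
    Vector_Spaces.linear (*\<^sub>C) (*) f \<and> (\<forall>a. cstar_positive a \<longrightarrow> f a \<in> \<real>\<^sub>\<ge>\<^sub>0)"

definition strictly_positive :: "'a::unital_cstar_algebra \<Rightarrow> bool"
  where "strictly_positive a \<longleftrightarrow>
    (\<forall>f. positive_linear_form f \<and> (\<exists>b. f b \<noteq> 0) \<longrightarrow> f a \<in> \<real> \<and> Re (f a) > 0)"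

definition central :: "'a::unital_cstar_algebra \<Rightarrow> bool"
  where "central a \<longleftrightarrow> (\<forall>b. a * b = b * a)"

definition module_abs :: "('h \<Rightarrow> 'h \<Rightarrow> 'a::unital_cstar_algebra) \<Rightarrow> 'h \<Rightarrow> 'a"
  where "module_abs ip x = positive_sqrt (ip x x)"

(* Left Hilbert modules. The real scaling and the norm of the Banach space type 'h are
   determined by the action and the inner product through act_scaleR and norm_eq, so
   completeness and closedness refer to the module norm; complex scalars c act as
   act (c *\<^sub>C 1). *)
locale hilbert_module =
  fixes act :: "'a::unital_cstar_algebra \<Rightarrow> 'h::banach \<Rightarrow> 'h"
    and ip :: "'h \<Rightarrow> 'h \<Rightarrow> 'a"
  assumes act_add_right: "act a (x + y) = act a x + act a y"
    and act_add_left: "act (a + b) x = act a x + act b x"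
    and act_act: "act a (act b x) = act (a * b) x"
    and act_one: "act 1 x = x"
    and act_scaleR: "act (r *\<^sub>R 1) x = r *\<^sub>R x"
    and ip_add_left: "ip (x + y) z = ip x z + ip y z"
    and ip_act_left: "ip (act a x) y = a * ip x y"
    and ip_star: "star (ip x y) = ip y x"
    and ip_positive: "cstar_positive (ip x x)"
    and ip_definite: "ip x x = 0 \<Longrightarrow> x = 0"
    and norm_eq: "norm x = norm (module_abs ip x)"

definition is_submodule :: "('a::unital_cstar_algebra \<Rightarrow> 'h::banach \<Rightarrow> 'h) \<Rightarrow> 'h set \<Rightarrow> bool"
  where "is_submodule act K \<longleftrightarrow>
    0 \<in> K \<and> (\<forall>x\<in>K. \<forall>y\<in>K. x + y \<in> K) \<and> (\<forall>a. \<forall>x\<in>K. act a x \<in> K)"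

definition orth_complement :: "('h \<Rightarrow> 'h \<Rightarrow> 'a::unital_cstar_algebra) \<Rightarrow> 'h set \<Rightarrow> 'h set"
  where "orth_complement ip K = {u. \<forall>x\<in>K. ip u x = 0}"

definition orthogonally_complemented ::
    "('a::unital_cstar_algebra \<Rightarrow> 'h::banach \<Rightarrow> 'h) \<Rightarrow> ('h \<Rightarrow> 'h \<Rightarrow> 'a) \<Rightarrow> 'h set \<Rightarrow> bool"
  where "orthogonally_complemented act ip K \<longleftrightarrow>
    is_submodule act K \<and> closed K \<and>
    {x + y |x y. x \<in> K \<and> y \<in> orth_complement ip K} = UNIV \<and>
    K \<inter> orth_complement ip K = {0}"

definition orth_projection ::
    "('h::banach \<Rightarrow> 'h \<Rightarrow> 'a::unital_cstar_algebra) \<Rightarrow> 'h set \<Rightarrow> 'h \<Rightarrow> 'h"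
  where "orth_projection ip K x = (THE y. y \<in> K \<and> x - y \<in> orth_complement ip K)"

(* Sequences over the positive integers are functions on nat with index shifted by one:
   \<omega> n and K n stand for the terms of index n + 1. *)
definition weight :: "(nat \<Rightarrow> 'a::unital_cstar_algebra) \<Rightarrow> bool"
  where "weight \<omega> \<longleftrightarrow> (\<forall>n. central (\<omega> n) \<and> strictly_positive (\<omega> n))"

definition star_fusion_frame ::
    "('a::unital_cstar_algebra \<Rightarrow> 'h::banach \<Rightarrow> 'h) \<Rightarrow> ('h \<Rightarrow> 'h \<Rightarrow> 'a) \<Rightarrow>
      (nat \<Rightarrow> 'h set) \<Rightarrow> (nat \<Rightarrow> 'a) \<Rightarrow> bool"
  where "star_fusion_frame act ip K \<omega> \<longleftrightarrow>
    (\<forall>x. summable (\<lambda>n. (\<omega> n)\<^sup>2 * (module_abs ip (orth_projection ip (K n) x))\<^sup>2)) \<and>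
    (\<exists>A B. strictly_positive A \<and> strictly_positive B \<and>
      (\<forall>x. (module_abs ip (act A x))\<^sup>2
              \<preceq> (\<Sum>n. (\<omega> n)\<^sup>2 * (module_abs ip (orth_projection ip (K n) x))\<^sup>2) \<and>
           (\<Sum>n. (\<omega> n)\<^sup>2 * (module_abs ip (orth_projection ip (K n) x))\<^sup>2)
              \<preceq> (module_abs ip (act B x))\<^sup>2))"

definition frame_weights ::
    "('a::unital_cstar_algebra \<Rightarrow> 'h::banach \<Rightarrow> 'h) \<Rightarrow> ('h \<Rightarrow> 'h \<Rightarrow> 'a) \<Rightarrow>
      (nat \<Rightarrow> 'h set) \<Rightarrow> (nat \<Rightarrow> 'a) set"
  where "frame_weights act ip K = {\<omega>. weight \<omega> \<and> star_fusion_frame act ip K \<omega>}"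

(* Not the convex_cone of HOL-Analysis, which is closed under multiplication by 0. *)
definition complex_convex_cone :: "(complex \<Rightarrow> 'v::ab_group_add \<Rightarrow> 'v) \<Rightarrow> 'v set \<Rightarrow> bool"
  where "complex_convex_cone smul W \<longleftrightarrow>
    vector_space smul \<and> W \<noteq> {} \<and>
    (\<forall>x\<in>W. \<forall>y\<in>W. x + y \<in> W) \<and>
    (\<forall>x\<in>W. \<forall>r::real. r > 0 \<longrightarrow> smul (complex_of_real r) x \<in> W)"

definition seq_scaleC :: "complex \<Rightarrow> (nat \<Rightarrow> 'a::unital_cstar_algebra) \<Rightarrow> nat \<Rightarrow> 'a"
  where "seq_scaleC c s = (\<lambda>n. c *\<^sub>C s n)"

end

(* With S(x) the frame sum of a weight, (a+b)^2 p - a^2 p and 2 a^2 p + 2 b^2 p - (a+b)^2 p are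
   positive for commuting positive central a, b and positive p; so the frame sum of the sum of two
   weights converges, keeps the lower bound of the first weight and is at most twice the sum of the
   two frame sums. Since S(ax) = a S(x) a*, an upper bound |Bx|^2 for S improves to ||B||^2 |x|^2,
   and the resulting scalar bounds can be added.

   This rests on two facts about C*-algebras: elements b* b are the positive elements (Kaplansky),
   and a strictly positive element is positive, which follows by separating a self-adjoint element
   from the positive cone with a positive linear form (M. Riesz extension). *)

theory Submission
  imports Defs
begin

section \<open>The involution\<close>

text \<open>Positivity is given as the mere existence of a factorisation \<open>star b * b\<close>,
  a form that shows neither closure under sums nor closure under limits, and frame sums need both.
  The workable substitute is the norm criterion \<open>norm (t *\<^sub>R 1 - p) \<le> t\<close>: it
  adds by the triangle inequality, and square roots then come from an iteration with polynomial
  iterates, so no spectral theory enters. Limits of such iterates inherit commutation relations,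
  which takes the place of a functional calculus. Strict positivity, in turn, speaks only of values
  of linear forms, so even self-adjointness of a weight has to be extracted from it. Conversely the
  upper bound for a sum of weights must itself be strictly positive, and a positive multiple of 1
  serves. The frame series converge in norm but not necessarily absolutely, so they are compared
  through the order on whole blocks of terms.\<close>

lemma star_zero [simp]: "star (0::'a::unital_cstar_algebra) = 0"
  using star_add[of "0::'a" 0] by simp

lemma star_minus: "star (- a) = - star (a::'a::unital_cstar_algebra)"
proof -
  have "star a + star (- a) = 0"
    by (simp flip: star_add)
  then show ?thesis
    by (simp add: eq_neg_iff_add_eq_0 add.commute)
qed

lemma star_diff: "star (a - b) = star a - star (b::'a::unital_cstar_algebra)"
  using star_add[of a "- b"] by (simp add: star_minus)

lemma star_one [simp]: "star (1::'a::unital_cstar_algebra) = 1"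
  by (metis mult_1 mult_1_right star_mult star_star)

lemma star_scaleR: "star (r *\<^sub>R a) = r *\<^sub>R star (a::'a::unital_cstar_algebra)"
  by (simp add: scaleR_scaleC star_scaleC)

lemma norm_star: "norm (star a) = norm (a::'a::unital_cstar_algebra)"
proof -
  have le: "norm b \<le> norm (star b)" for b :: 'a
  proof (cases "norm b = 0")
    case False
    have "norm b * norm b \<le> norm (star b) * norm b"
      using cstar_identity[of b] norm_mult_ineq[of "star b" b] by (simp add: power2_eq_square)
    with False show ?thesis
      by simp
  qed auto
  show ?thesis
    using le[of a] le[of "star a"] by (simp add: star_star)
qed

lemma cstar_zero_iff: "star a * a = 0 \<longleftrightarrow> a = (0::'a::unital_cstar_algebra)"
  using cstar_identity[of a] by auto

lemma norm_square_self_adjoint: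
  "star s = s \<Longrightarrow> norm (s * s) = norm s * norm (s::'a::unital_cstar_algebra)"
  using cstar_identity[of s] by (simp add: power2_eq_square)

text \<open>The norm of 1 equals its own square; it is 1 except in the zero algebra, where it is 0,
  and the inequality covers both.\<close>

lemma norm_one_le: "norm (1::'a::unital_cstar_algebra) \<le> 1"
proof -
  have "norm (1::'a) * norm (1::'a) = norm (1::'a)"
    using norm_square_self_adjoint[of "1::'a"] by simp
  then show ?thesis
    by (metis mult_cancel_right1 order.refl zero_le_one)
qed

lemma norm_scaleR_one_le: "norm (t *\<^sub>R (1::'a::unital_cstar_algebra)) \<le> \<bar>t\<bar>"
  using norm_one_le[where 'a='a] by (simp add: mult_left_le)

lemma tendsto_star:
  fixes l :: "'a::unital_cstar_algebra"
  assumes "(f \<longlongrightarrow> l) F"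
  shows "((\<lambda>x. star (f x)) \<longlongrightarrow> star l) F"
proof -
  have "((\<lambda>x. norm (f x - l)) \<longlongrightarrow> 0) F"
    using assms by (simp add: LIM_zero tendsto_norm_zero)
  then have "((\<lambda>x. norm (star (f x) - star l)) \<longlongrightarrow> 0) F"
    by (simp add: norm_star flip: star_diff)
  then show ?thesis
    by (rule LIM_zero_cancel[OF tendsto_norm_zero_cancel])
qed

lemma self_adjoint_cube_zero:
  fixes d :: "'a::unital_cstar_algebra"
  assumes "star d = d" "d * d * d = 0"
  shows "d = 0"
proof -
  have "(d * d) * (d * d) = 0"
    using assms(2) by (metis mult.assoc mult_zero_left)
  then have "d * d = 0"
    using cstar_zero_iff[of "d * d"] assms(1) by (simp add: star_mult)
  then show ?thesis
    using cstar_zero_iff[of d] assms(1) by simp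
qed

text \<open>\<open>s\<close> is the real part of \<open>u = s + \<i> *\<^sub>C r\<close>, and
  \<open>star u * u\<close> is \<open>s * s + r * r\<close> because \<open>s\<close> and
  \<open>r\<close> commute. A real part has norm at most \<open>norm u\<close>, and the C*-identity
  computes the latter.\<close>

lemma two_squares_norm:
  fixes s r :: "'a::unital_cstar_algebra"
  assumes s: "star s = s" and r: "star r = r" and c: "s * r = r * s"
  shows "norm s * norm s \<le> norm (s * s + r * r)"
proof -
  define u where "u = s + \<i> *\<^sub>C r"
  have su: "star u = s + (- \<i>) *\<^sub>C r"
    by (simp add: u_def star_add star_scaleC s r)
  have m: "(- \<i>) *\<^sub>C a + \<i> *\<^sub>C a = 0" for a :: 'a
    using scaleC_add_left[of "-\<i>" \<i> a] scaleR_scaleC[of 0 a] by simp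
  have "star u * u = s * s + r * r + ((- \<i>) *\<^sub>C (r * s) + \<i> *\<^sub>C (r * s))"
    unfolding su unfolding u_def
    by (simp add: distrib_left distrib_right mult_scaleC_left mult_scaleC_right scaleC_scaleC
        scaleC_one scaleC_add_right c add_ac)
  then have "star u * u = s * s + r * r"
    by (simp only: m add_0_right)
  then have n: "(norm u)\<^sup>2 = norm (s * s + r * r)"
    using cstar_identity[of u] by simp
  have "u + star u = 2 *\<^sub>R s + ((- \<i>) *\<^sub>C r + \<i> *\<^sub>C r)"
    unfolding su by (simp add: u_def scaleR_2)
  then have "u + star u = 2 *\<^sub>R s"
    by (simp only: m add_0_right)
  then have "2 * norm s \<le> 2 * norm u"
    using norm_triangle_ineq[of u "star u"] by (simp add: norm_star)
  then have "norm s * norm s \<le> norm u * norm u"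
    by (intro mult_mono) auto
  then show ?thesis
    using n by (simp add: power2_eq_square)
qed

section \<open>Square roots\<close>

text \<open>A fixed point \<open>y\<close> of this step satisfies
  \<open>(1 - y) * (1 - y) = 1 - x\<close>, so the limit is 1 minus a square root of
  \<open>1 - x\<close>.\<close>

fun root_seq :: "'a::unital_cstar_algebra \<Rightarrow> nat \<Rightarrow> 'a" where
  "root_seq x 0 = 0"
| "root_seq x (Suc n) = (1/2) *\<^sub>R (x + root_seq x n * root_seq x n)"

text \<open>The increments of the iteration at \<open>x\<close> are dominated by those of the scalar iteration at 1,
  which increases to its fixed point 1.\<close>

fun root_bound :: "nat \<Rightarrow> real" where
  "root_bound 0 = 0"
| "root_bound (Suc n) = (1 + root_bound n * root_bound n) / 2"

lemma root_bound_range: "0 \<le> root_bound n \<and> root_bound n \<le> 1"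
proof (induction n)
  case (Suc n)
  then show ?case
    using mult_mono[of "root_bound n" 1 "root_bound n" 1] by auto
qed simp

lemma root_bound_mono: "root_bound n \<le> root_bound (Suc n)"
proof -
  have "0 \<le> (root_bound n - 1) * (root_bound n - 1)"
    by simp
  then show ?thesis
    by (simp add: algebra_simps)
qed

text \<open>Two base points rather than one: Kaplansky's argument moves \<open>c\<close> from a root
  built on the square of \<open>star c * c\<close> to one built on the square of
  \<open>c * star c\<close>.\<close>

lemma root_seq_intertwine: "c * x = x' * c \<Longrightarrow> c * root_seq x n = root_seq x' n * c"
proof (induction n)
  case (Suc n)
  then have "c * (root_seq x n * root_seq x n) = (root_seq x' n * root_seq x' n) * c"
    by (metis mult.assoc)
  with Suc show ?case
    by (simp add: distrib_left distrib_right)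
qed simp

lemma root_seq_star: "star x = x \<Longrightarrow> star (root_seq x n) = root_seq x n"
  by (induction n) (auto simp: star_scaleR star_add star_mult)

lemma root_seq_norm:
  assumes "norm x \<le> 1"
  shows "norm (root_seq x n) \<le> root_bound n"
proof (induction n)
  case (Suc n)
  have "norm (root_seq x n * root_seq x n) \<le> root_bound n * root_bound n"
    using Suc norm_mult_ineq[of "root_seq x n" "root_seq x n"]
    by (meson mult_mono norm_ge_zero order_trans)
  then show ?case
    using assms norm_triangle_ineq[of x "root_seq x n * root_seq x n"] by simp
qed simp

text \<open>Consecutive iterates commute, so half the difference of their squares factors as half of
  sum times difference. The scalar increments factor in the same way, and the induction compares
  factor by factor.\<close>

lemma root_seq_increment:
  assumes "norm x \<le> 1"
  shows "norm (root_seq x (Suc n) - root_seq x n) \<le> root_bound (Suc n) - root_bound n"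
proof (induction n)
  case 0
  then show ?case using assms by simp
next
  case (Suc n)
  let ?a = "root_seq x (Suc n)" and ?b = "root_seq x n"
  let ?s = "root_bound (Suc n)" and ?t = "root_bound n"
  \<comment> \<open>Intertwining is used twice: each iterate commutes with \<open>x\<close>, and
    whatever commutes with \<open>x\<close> commutes with each iterate.\<close>
  have "x * ?b = ?b * x"
    by (rule root_seq_intertwine) simp
  then have "?b * x = x * ?b"
    by simp
  then have c: "?b * ?a = ?a * ?b"
    by (rule root_seq_intertwine)
  have "root_seq x (Suc (Suc n)) - ?a = (1/2) *\<^sub>R (?a * ?a - ?b * ?b)"
    unfolding root_seq.simps(2)[of x "Suc n"] by (subst (5) root_seq.simps(2)) (simp add: algebra_simps)
  also have "?a * ?a - ?b * ?b = (?a + ?b) * (?a - ?b)"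
    using c by (simp add: algebra_simps del: root_seq.simps)
  finally have "norm (root_seq x (Suc (Suc n)) - ?a) = norm ((?a + ?b) * (?a - ?b)) / 2"
    by (simp del: root_seq.simps)
  also have "\<dots> \<le> (?s + ?t) * (?s - ?t) / 2"
  proof -
    have "norm (?a + ?b) \<le> ?s + ?t"
      using norm_triangle_ineq[of ?a ?b] root_seq_norm[OF assms, of "Suc n"]
        root_seq_norm[OF assms, of n] by linarith
    then have "norm (?a + ?b) * norm (?a - ?b) \<le> (?s + ?t) * (?s - ?t)"
      using Suc.IH by (intro mult_mono) (use root_bound_range[of n] root_bound_range[of "Suc n"] in auto)
    then show ?thesis
      using norm_mult_ineq[of "?a + ?b" "?a - ?b"] by linarith
  qed
  also have "\<dots> = root_bound (Suc (Suc n)) - ?s"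
  proof -
    have t: "?t * ?t = 2 * ?s - 1"
      by (simp add: field_simps)
    show ?thesis
      unfolding root_bound.simps(2)[of "Suc n"] using t
      by (simp add: algebra_simps add_divide_distrib diff_divide_distrib del: root_bound.simps)
  qed
  finally show ?case .
qed

text \<open>For \<open>norm x = 1\<close> the step need not be a contraction; summability of the
  increments comes from the telescoping scalar bounds instead.\<close>

lemma root_seq_convergent:
  assumes "norm x \<le> 1"
  shows "convergent (root_seq x)"
proof -
  have "convergent root_bound"
  proof (rule Bseq_mono_convergent)
    show "Bseq root_bound"
      by (rule BseqI'[of _ 1]) (use root_bound_range in auto)
    show "\<forall>m n. m \<le> n \<longrightarrow> root_bound m \<le> root_bound n"
      using lift_Suc_mono_le[of root_bound] root_bound_mono by blast
  qed
  then have "summable (\<lambda>n. root_bound (Suc n) - root_bound n)"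
    using telescope_summable convergent_LIMSEQ_iff by blast
  then have "summable (\<lambda>n. root_seq x (Suc n) - root_seq x n)"
    by (rule summable_comparison_test'[where N=0]) (use root_seq_increment[OF assms] in blast)
  then have "convergent (\<lambda>n. \<Sum>i<n. root_seq x (Suc i) - root_seq x i)"
    by (simp only: summable_iff_convergent)
  then show ?thesis
    by (simp only: sum_lessThan_telescope root_seq.simps(1) diff_zero)
qed

definition sqrt_one_minus :: "'a::unital_cstar_algebra \<Rightarrow> 'a"
  where "sqrt_one_minus x = 1 - lim (root_seq x)"

lemma root_seq_LIMSEQ:
  "norm x \<le> 1 \<Longrightarrow> root_seq x \<longlonglongrightarrow> 1 - sqrt_one_minus x"
  unfolding sqrt_one_minus_def using convergent_LIMSEQ_iff root_seq_convergent by fastforce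

lemma sqrt_one_minus_square:
  assumes "norm x \<le> 1"
  shows "sqrt_one_minus x * sqrt_one_minus x = 1 - x"
proof -
  let ?y = "1 - sqrt_one_minus x"
  have "(\<lambda>n. root_seq x (Suc n)) \<longlonglongrightarrow> (1/2) *\<^sub>R (x + ?y * ?y)"
    unfolding root_seq.simps by (intro tendsto_intros root_seq_LIMSEQ assms)
  moreover have "(\<lambda>n. root_seq x (Suc n)) \<longlonglongrightarrow> ?y"
    using root_seq_LIMSEQ[OF assms] by (simp only: filterlim_sequentially_Suc)
  ultimately have "?y = (1/2) *\<^sub>R (x + ?y * ?y)"
    using LIMSEQ_unique by blast
  then have "2 *\<^sub>R ?y = x + ?y * ?y"
    by (metis scaleR_half_double scaleR_2 scaleR_right.add)
  then show ?thesis
    by (simp add: algebra_simps scaleR_2)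
qed

text \<open>This is the norm criterion, with \<open>t = 1\<close>, for positivity of the
  root.\<close>

lemma sqrt_one_minus_norm:
  assumes "norm x \<le> 1"
  shows "norm (1 - sqrt_one_minus x) \<le> 1"
proof (rule LIMSEQ_le_const2)
  show "(\<lambda>n. norm (root_seq x n)) \<longlonglongrightarrow> norm (1 - sqrt_one_minus x)"
    by (intro tendsto_norm root_seq_LIMSEQ assms)
  have "norm (root_seq x n) \<le> 1" for n
    using root_seq_norm[OF assms, of n] root_bound_range[of n] by linarith
  then show "\<exists>N. \<forall>n\<ge>N. norm (root_seq x n) \<le> 1"
    by blast
qed

lemma sqrt_one_minus_star:
  assumes "norm x \<le> 1" "star x = x"
  shows "star (sqrt_one_minus x) = sqrt_one_minus x"
proof -
  have "root_seq x \<longlonglongrightarrow> star (1 - sqrt_one_minus x)"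
    using tendsto_star[OF root_seq_LIMSEQ[OF assms(1)]] assms(2) by (simp add: root_seq_star)
  then have "star (1 - sqrt_one_minus x) = 1 - sqrt_one_minus x"
    using root_seq_LIMSEQ[OF assms(1)] by (rule LIMSEQ_unique)
  then show ?thesis
    by (simp add: star_diff)
qed

lemma sqrt_one_minus_intertwine:
  assumes "norm x \<le> 1" "norm x' \<le> 1" "c * x = x' * c"
  shows "c * sqrt_one_minus x = sqrt_one_minus x' * c"
proof -
  have "(\<lambda>n. c * root_seq x n) \<longlonglongrightarrow> c * (1 - sqrt_one_minus x)"
    "(\<lambda>n. root_seq x' n * c) \<longlonglongrightarrow> (1 - sqrt_one_minus x') * c"
    by (intro tendsto_mult_left tendsto_mult_right root_seq_LIMSEQ assms)+
  then have "c * (1 - sqrt_one_minus x) = (1 - sqrt_one_minus x') * c"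
    using LIMSEQ_unique root_seq_intertwine[OF assms(3)] by auto
  then show ?thesis
    by (simp add: algebra_simps)
qed

section \<open>Positivity through the norm\<close>

text \<open>A convex and closed description of positivity; it coincides with \<^const>\<open>cstar_positive\<close>
  by \<open>cstar_positive_iff\<close>.\<close>

definition norm_positive :: "'a::unital_cstar_algebra \<Rightarrow> bool"
  where "norm_positive p \<longleftrightarrow> star p = p \<and> (\<exists>t. norm (t *\<^sub>R 1 - p) \<le> t)"

lemma norm_positive_star: "norm_positive p \<Longrightarrow> star p = p"
  by (simp add: norm_positive_def)

lemma norm_positive_add:
  assumes "norm_positive p" "norm_positive q"
  shows "norm_positive (p + q)"
proof -
  obtain s t where "norm (s *\<^sub>R 1 - p) \<le> s" "norm (t *\<^sub>R 1 - q) \<le> t"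
    using assms by (auto simp: norm_positive_def)
  then have "norm ((s *\<^sub>R 1 - p) + (t *\<^sub>R 1 - q)) \<le> s + t"
    by (rule norm_triangle_mono)
  then have "norm ((s + t) *\<^sub>R 1 - (p + q)) \<le> s + t"
    by (simp add: algebra_simps)
  then show ?thesis
    using assms by (auto simp: norm_positive_def star_add)
qed

lemma norm_positive_scaleR:
  assumes "norm_positive p" "0 \<le> r"
  shows "norm_positive (r *\<^sub>R p)"
proof -
  obtain t where "norm (t *\<^sub>R 1 - p) \<le> t"
    using assms by (auto simp: norm_positive_def)
  then have "norm (r *\<^sub>R (t *\<^sub>R 1 - p)) \<le> r * t"
    using assms(2) by (simp add: mult_left_mono)
  then have "norm ((r * t) *\<^sub>R 1 - r *\<^sub>R p) \<le> r * t"
    by (simp add: scaleR_diff_right)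
  then show ?thesis
    using assms by (auto simp: norm_positive_def star_scaleR)
qed

lemma norm_positive_one: "norm_positive 1"
  unfolding norm_positive_def by (auto intro: exI[of _ 1])

lemma norm_positive_zero: "norm_positive 0"
  unfolding norm_positive_def by (auto intro: exI[of _ 0])

text \<open>After scaling \<open>s\<close> to a \<open>u\<close> of norm 1, the iteration writes
  \<open>1 - u * u\<close> as \<open>r * r\<close> with \<open>r\<close> self-adjoint and commuting
  with \<open>u\<close>. Then \<open>two_squares_norm\<close> bounds \<open>r * r\<close> by
  \<open>r * r + u * u = 1\<close>.\<close>

lemma self_adjoint_square_norm_positive:
  assumes "star s = s"
  shows "norm (norm (s * s) *\<^sub>R 1 - s * s) \<le> norm (s * s)"
proof (cases "s = 0")
  case False
  define k where "k = norm s"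
  have k: "k > 0" using False by (simp add: k_def)
  define u where "u = (1/k) *\<^sub>R s"
  have su: "star u = u" and nu: "norm u = 1"
    using k by (auto simp: u_def star_scaleR assms k_def)
  have nuu: "norm (u * u) \<le> 1" and suu: "star (u * u) = u * u"
    using norm_square_self_adjoint[OF su] nu by (auto simp: star_mult su)
  define r where "r = sqrt_one_minus (u * u)"
  have sr: "star r = r" and rr: "r * r = 1 - u * u"
    using sqrt_one_minus_star[OF nuu suu] sqrt_one_minus_square[OF nuu] by (auto simp: r_def)
  have "r * u = u * r"
    using sqrt_one_minus_intertwine[OF nuu nuu, of u] by (simp add: r_def mult.assoc)
  then have "norm r * norm r \<le> norm (r * r + u * u)"
    by (intro two_squares_norm sr su)
  also have "\<dots> \<le> 1"
    using norm_one_le by (simp add: rr)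
  finally have "norm (1 - u * u) \<le> 1"
    using norm_square_self_adjoint[OF sr] by (simp add: rr)
  moreover have "norm (s * s) *\<^sub>R 1 - s * s = (k * k) *\<^sub>R (1 - u * u)"
    using k norm_square_self_adjoint[OF assms] by (simp add: u_def k_def algebra_simps)
  moreover have "norm (s * s) = k * k"
    using norm_square_self_adjoint[OF assms] by (simp add: k_def)
  ultimately show ?thesis
    using k by (simp add: mult_left_le)
qed simp

lemma norm_positive_square:
  "star s = s \<Longrightarrow> norm_positive (s * s)"
  using self_adjoint_square_norm_positive[of s] by (auto simp: norm_positive_def star_mult)

text \<open>For \<open>t > 0\<close> the norm criterion says that
  \<open>1 - (1/t) *\<^sub>R p\<close> lies in the unit ball, where the iteration converges. The
  commutation clause is inherited from the iterates and later makes roots of commuting elements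
  commute.\<close>

lemma norm_positive_root:
  assumes "norm_positive p"
  obtains s where "norm_positive s" "s * s = p" "\<forall>c. c * p = p * c \<longrightarrow> c * s = s * c"
proof -
  obtain t0 where sp: "star p = p" and t0: "norm (t0 *\<^sub>R 1 - p) \<le> t0"
    using assms by (auto simp: norm_positive_def)
  show ?thesis
  proof (cases "t0 = 0")
    case True
    with t0 have "p = 0" by simp
    then show ?thesis
      using that[of 0] norm_positive_zero by simp
  next
    case False
    then have t: "t0 > 0"
      using t0 norm_ge_zero[of "t0 *\<^sub>R 1 - p"] by linarith
    define x where "x = 1 - (1/t0) *\<^sub>R p"
    have "x = (1/t0) *\<^sub>R (t0 *\<^sub>R 1 - p)"
      using t by (simp add: x_def scaleR_diff_right)
    then have x: "norm x \<le> 1"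
      using t t0 by (simp add: divide_simps)
    have sx: "star x = x"
      by (simp add: x_def star_diff star_scaleR sp)
    let ?r = "sqrt_one_minus x"
    have "norm_positive ?r"
      using sqrt_one_minus_norm[OF x] sqrt_one_minus_star[OF x sx]
      by (auto simp: norm_positive_def intro!: exI[of _ 1])
    then have "norm_positive (sqrt t0 *\<^sub>R ?r)"
      using t by (intro norm_positive_scaleR) auto
    moreover have "(sqrt t0 *\<^sub>R ?r) * (sqrt t0 *\<^sub>R ?r) = p"
      using t sqrt_one_minus_square[OF x] by (simp add: x_def)
    moreover have "\<forall>c. c * p = p * c \<longrightarrow> c * (sqrt t0 *\<^sub>R ?r) = (sqrt t0 *\<^sub>R ?r) * c"
      using sqrt_one_minus_intertwine[OF x x] by (simp add: x_def algebra_simps)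
    ultimately show ?thesis
      by (rule that)
  qed
qed

text \<open>Writing \<open>p\<close> as a square replaces the unknown \<open>t\<close> of the
  criterion by \<open>norm p\<close>. This choice depends continuously on \<open>p\<close>, which is
  what makes positivity pass to limits.\<close>

lemma norm_positive_norm_bound:
  assumes "norm_positive p" "norm p \<le> t"
  shows "norm (t *\<^sub>R 1 - p) \<le> t"
proof -
  obtain s where s: "norm_positive s" "s * s = p"
    using norm_positive_root[OF assms(1)] by metis
  have "norm (norm p *\<^sub>R 1 - p) \<le> norm p"
    using self_adjoint_square_norm_positive[OF norm_positive_star[OF s(1)]] s(2) by simp
  moreover have "norm ((t - norm p) *\<^sub>R (1::'a)) \<le> t - norm p"
    using norm_scaleR_one_le[of "t - norm p", where 'a='a] assms(2) by simp
  ultimately have "norm ((norm p *\<^sub>R 1 - p) + (t - norm p) *\<^sub>R 1) \<le> norm p + (t - norm p)"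
    by (rule norm_triangle_mono)
  then show ?thesis
    by (simp add: algebra_simps)
qed

lemma self_adjoint_upper:
  assumes "star x = x" "norm x \<le> t"
  shows "norm_positive (t *\<^sub>R 1 - x)"
proof -
  have "norm (t *\<^sub>R 1 - (t *\<^sub>R 1 - x)) \<le> t"
    using assms by simp
  then show ?thesis
    unfolding norm_positive_def by (metis assms(1) star_diff star_one star_scaleR)
qed

lemma norm_positive_LIMSEQ:
  fixes p :: "'a::unital_cstar_algebra"
  assumes lim: "f \<longlonglongrightarrow> p" and f: "\<And>n. norm_positive (f n)"
  shows "norm_positive p"
proof -
  have "f \<longlonglongrightarrow> star p"
    using tendsto_star[OF lim] f by (simp add: norm_positive_star)
  then have "star p = p"
    using lim by (rule LIMSEQ_unique)
  moreover have "norm (norm p *\<^sub>R 1 - p) \<le> norm p"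
  proof (rule LIMSEQ_le)
    show "(\<lambda>n. norm (norm (f n) *\<^sub>R 1 - f n)) \<longlonglongrightarrow> norm (norm p *\<^sub>R 1 - p)"
      by (intro tendsto_intros lim)
    show "(\<lambda>n. norm (f n)) \<longlonglongrightarrow> norm p"
      by (intro tendsto_intros lim)
  qed (use norm_positive_norm_bound[OF f] in auto)
  ultimately show ?thesis
    by (auto simp: norm_positive_def)
qed

lemma norm_positive_eps:
  fixes p q :: "'a::unital_cstar_algebra"
  assumes "\<And>e. 0 < e \<Longrightarrow> norm_positive (p + e *\<^sub>R q)"
  shows "norm_positive p"
proof (rule norm_positive_LIMSEQ)
  show "(\<lambda>n. p + inverse (real (Suc n)) *\<^sub>R q) \<longlonglongrightarrow> p"
    using tendsto_add[OF tendsto_const[of p] tendsto_scaleR[OF LIMSEQ_inverse_real_of_nat tendsto_const[of q]]]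
    by simp
qed (use assms in simp)

text \<open>The commutation clause of the roots is applied to \<open>p\<close> and then to
  \<open>q\<close>, so both roots commute and \<open>two_squares_norm\<close> applies to
  them.\<close>

lemma norm_positive_two_norm:
  fixes p q :: "'a::unital_cstar_algebra"
  assumes p: "norm_positive p" and q: "norm_positive q" and c: "p * q = q * p"
  shows "norm p \<le> norm (p + q)"
proof -
  obtain s where s: "norm_positive s" "s * s = p" "\<forall>c. c * p = p * c \<longrightarrow> c * s = s * c"
    by (rule norm_positive_root[OF p])
  obtain r where r: "norm_positive r" "r * r = q" "\<forall>c. c * q = q * c \<longrightarrow> c * r = r * c"
    by (rule norm_positive_root[OF q])
  have "q * s = s * q"
    using s(3) c by metis
  then have "s * r = r * s"
    using r(3) by metis
  then have "norm s * norm s \<le> norm (p + q)"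
    using two_squares_norm[OF norm_positive_star[OF s(1)] norm_positive_star[OF r(1)]] s(2) r(2) by simp
  then show ?thesis
    using norm_square_self_adjoint[OF norm_positive_star[OF s(1)]] s(2) by simp
qed

lemma norm_positive_antisym:
  assumes "norm_positive p" "norm_positive (- p)"
  shows "p = 0"
  using norm_positive_two_norm[OF assms] by simp

lemma norm_positive_add_eq_0:
  assumes "norm_positive p" "norm_positive q" "p + q = 0"
  shows "p = 0" "q = 0"
proof -
  have "q = - p"
    using assms(3) by (simp add: eq_neg_iff_add_eq_0 add.commute)
  then show "p = 0" "q = 0"
    using norm_positive_antisym assms(1,2) by auto
qed

text \<open>\<open>u\<close> and \<open>v\<close> may fail to commute, so \<open>v\<close> is first
  replaced by the larger scalar \<open>norm v *\<^sub>R 1\<close>, which commutes with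
  \<open>u\<close>.\<close>

lemma norm_positive_mono:
  fixes u v :: "'a::unital_cstar_algebra"
  assumes u: "norm_positive u" and vu: "norm_positive (v - u)"
  shows "norm u \<le> norm v"
proof -
  have "norm_positive v"
    using norm_positive_add[OF u vu] by simp
  then have "norm_positive ((norm v *\<^sub>R 1 - v) + (v - u))"
    by (intro norm_positive_add self_adjoint_upper vu norm_positive_star \<open>norm_positive v\<close>) simp
  then have "norm_positive (norm v *\<^sub>R 1 - u)"
    by simp
  then have "norm u \<le> norm (u + (norm v *\<^sub>R 1 - u))"
    by (intro norm_positive_two_norm u) (simp_all add: algebra_simps)
  also have "\<dots> \<le> norm v"
    using norm_scaleR_one_le[of "norm v", where 'a='a] by simp
  finally show ?thesis .
qed

lemma norm_positive_mult_square:
  assumes d: "star d = d" and a: "norm_positive a" and c: "d * a = a * d"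
  shows "norm_positive (d * a * d)"
proof -
  obtain s where s: "norm_positive s" "s * s = a" "\<forall>c. c * a = a * c \<longrightarrow> c * s = s * c"
    by (rule norm_positive_root[OF a])
  have ds: "d * s = s * d"
    using s(3) c by simp
  have "d * a * d = (d * s) * (d * s)"
    using ds s(2) by (metis mult.assoc)
  moreover have "star (d * s) = d * s"
    using d norm_positive_star[OF s(1)] ds by (simp add: star_mult)
  ultimately show ?thesis
    using norm_positive_square[of "d * s"] by simp
qed

text \<open>\<open>a\<close> and \<open>b\<close> are not known to commute, so each is compared with
  the root \<open>s\<close>, which commutes with everything commuting with \<open>b * b\<close>. For
  a root \<open>x\<close> and \<open>d = s - x\<close>, the identity \<open>(s + x) * d = 0\<close>
  makes the positive elements \<open>d * s * d\<close> and \<open>d * x * d\<close> sum to 0; both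
  vanish, hence so does the cube of \<open>d\<close>.\<close>

lemma norm_positive_root_unique:
  assumes a: "norm_positive a" and b: "norm_positive b" and eq: "a * a = b * b"
  shows "a = b"
proof -
  have p: "norm_positive (b * b)"
    by (intro norm_positive_square norm_positive_star b)
  obtain s where s: "norm_positive s" "s * s = b * b"
    "\<forall>c. c * (b * b) = (b * b) * c \<longrightarrow> c * s = s * c"
    by (rule norm_positive_root[OF p])
  have "x = s" if x: "norm_positive x" and xx: "x * x = b * b" for x
  proof -
    have c: "x * s = s * x"
      by (rule s(3)[rule_format]) (simp add: mult.assoc flip: xx)
    define d where "d = s - x"
    have d: "star d = d"
      by (simp add: d_def star_diff norm_positive_star x s(1))
    have ds: "d * s = s * d" and dx: "d * x = x * d"
      using c by (auto simp: d_def algebra_simps)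
    have "(s + x) * d = 0"
      using c s(2) xx by (simp add: d_def algebra_simps)
    then have "d * ((s + x) * d) = 0"
      by simp
    then have "d * s * d + d * x * d = 0"
      by (simp add: algebra_simps)
    then have "d * s * d = 0" "d * x * d = 0"
      using norm_positive_add_eq_0 norm_positive_mult_square[OF d] ds dx s(1) x by metis+
    then have "d * (s - x) * d = 0"
      by (simp add: algebra_simps)
    then have "d = 0"
      using self_adjoint_cube_zero[OF d] by (simp flip: d_def)
    then show ?thesis
      by (simp add: d_def)
  qed
  then show ?thesis
    using a b eq by metis
qed

text \<open>By uniqueness \<open>p\<close> and \<open>q\<close> are the roots produced by the
  iteration from their squares, and the iteration respects intertwining.\<close>

lemma square_root_intertwine:
  assumes p: "norm_positive p" and q: "norm_positive q" and c: "c * (p * p) = (q * q) * c"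
  shows "c * p = q * c"
proof -
  \<comment> \<open>One scale for both squares, so that \<open>c\<close> still intertwines the
    rescaled elements; the summand 1 keeps it positive.\<close>
  define t where "t = norm (p * p) + norm (q * q) + 1"
  have t: "t > 0"
    using norm_ge_zero[of "p * p"] norm_ge_zero[of "q * q"] unfolding t_def by linarith
  define X where "X y = 1 - (1/t) *\<^sub>R (y * y)" for y :: 'a
  have nX: "norm (X y) \<le> 1" and sX: "star (X y) = X y" and
    yX: "y = sqrt t *\<^sub>R sqrt_one_minus (X y)" if y: "norm_positive y" "norm (y * y) \<le> t" for y
  proof -
    have "norm (t *\<^sub>R 1 - y * y) \<le> t"
      by (intro norm_positive_norm_bound norm_positive_square norm_positive_star y)
    moreover have "X y = (1/t) *\<^sub>R (t *\<^sub>R 1 - y * y)"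
      using t by (simp add: X_def scaleR_diff_right)
    ultimately show n: "norm (X y) \<le> 1"
      using t by (simp add: divide_simps)
    show s: "star (X y) = X y"
      by (simp add: X_def star_diff star_scaleR star_mult norm_positive_star y)
    show "y = sqrt t *\<^sub>R sqrt_one_minus (X y)"
    proof (rule norm_positive_root_unique[OF y(1)])
      show "norm_positive (sqrt t *\<^sub>R sqrt_one_minus (X y))"
        using t sqrt_one_minus_norm[OF n] sqrt_one_minus_star[OF n s]
        by (intro norm_positive_scaleR) (auto simp: norm_positive_def intro!: exI[of _ 1])
      show "y * y = (sqrt t *\<^sub>R sqrt_one_minus (X y)) * (sqrt t *\<^sub>R sqrt_one_minus (X y))"
        using t sqrt_one_minus_square[OF n] by (simp add: X_def)
    qed
  qed
  have le: "norm (p * p) \<le> t" "norm (q * q) \<le> t"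
    by (simp_all add: t_def)
  have "c * X p = X q * c"
    using c by (simp add: X_def algebra_simps)
  then have "c * sqrt_one_minus (X p) = sqrt_one_minus (X q) * c"
    using nX p q le by (intro sqrt_one_minus_intertwine) auto
  then have "c * (sqrt t *\<^sub>R sqrt_one_minus (X p)) = (sqrt t *\<^sub>R sqrt_one_minus (X q)) * c"
    by simp
  then show ?thesis
    using yX[OF p le(1)] yX[OF q le(2)] by simp
qed

section \<open>Kaplansky's theorem on elements \<open>star b * b\<close>\<close>

text \<open>With real part \<open>x\<close> and imaginary part \<open>z\<close> of \<open>c\<close>,
  the mixed terms cancel and the sum is twice \<open>x * x + z * z\<close>, a sum of self-adjoint
  squares.\<close>

lemma star_mult_add_mult_star:
  fixes c :: "'a::unital_cstar_algebra"
  shows "norm_positive (star c * c + c * star c)"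
proof -
  define x where "x = (1/2) *\<^sub>R (c + star c)"
  define z where "z = (\<i>/2) *\<^sub>C (star c - c)"
  have c2: "(\<i>/2 * (\<i>/2)) *\<^sub>C a = - ((1/4) *\<^sub>R a)" for a :: 'a
    using scaleR_scaleC[of "-1/4" a] by simp
  have sx: "star x = x"
    by (simp add: x_def star_scaleR star_add star_star add.commute)
  have "(- w) *\<^sub>C (- a) = w *\<^sub>C a" for w :: complex and a :: 'a
    using scaleR_scaleC[of "-1" a] scaleC_scaleC[of "- w" "-1" a] by simp
  from this[of "\<i>/2" "star c - c"] have sz: "star z = z"
    by (simp add: z_def star_scaleC star_diff star_star)
  have "z * z = (\<i>/2 * (\<i>/2)) *\<^sub>C ((star c - c) * (star c - c))"
    by (simp add: z_def mult_scaleC_left mult_scaleC_right scaleC_scaleC)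
  then have zz: "z * z = - ((1/4) *\<^sub>R ((star c - c) * (star c - c)))"
    by (simp only: c2)
  have "x * x = (1/4) *\<^sub>R ((c + star c) * (c + star c))"
    by (simp add: x_def)
  with zz have "x * x + z * z
      = (1/4) *\<^sub>R ((c + star c) * (c + star c) - (star c - c) * (star c - c))"
    by (simp add: scaleR_diff_right)
  also have "(c + star c) * (c + star c) - (star c - c) * (star c - c)
      = 2 *\<^sub>R (star c * c + c * star c)"
    by (simp add: algebra_simps scaleR_2)
  finally have e: "star c * c + c * star c = 2 *\<^sub>R (x * x + z * z)"
    by simp
  show ?thesis
    unfolding e by (intro norm_positive_scaleR norm_positive_add norm_positive_square sx sz) simp
qed

text \<open>Intertwining replaces the usual comparison of the spectra of \<open>star c * c\<close>
  and \<open>c * star c\<close>. Both \<open>- (star c * c)\<close> and \<open>c * star c\<close>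
  are positive and \<open>c\<close> intertwines their squares, hence also the elements themselves;
  this equates \<open>c * star c * c\<close> with its negative.\<close>

lemma negative_star_mult_zero:
  fixes c :: "'a::unital_cstar_algebra"
  assumes p: "norm_positive (- (star c * c))"
  shows "c = 0"
proof -
  have "norm_positive (star c * c + c * star c + (- (star c * c)))"
    by (intro norm_positive_add star_mult_add_mult_star p)
  then have q: "norm_positive (c * star c)"
    by simp
  have "c * (- (star c * c)) = (c * star c) * c"
    by (rule square_root_intertwine[OF p q]) (simp add: mult.assoc)
  then have "c * star c * c + c * star c * c = 0"
    by (simp add: mult.assoc neg_eq_iff_add_eq_0)
  then have "c * star c * c = 0"
    by (simp flip: scaleR_2)
  then have "star (star c * c) * (star c * c) = 0"
    by (simp add: star_mult star_star mult.assoc)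
  then show ?thesis
    using cstar_zero_iff[of "star c * c"] cstar_zero_iff[of c] by simp
qed

text \<open>Kaplansky's argument: for \<open>a = b\<^sup>* b\<close> and twice the negative part \<open>n\<close> of \<open>a\<close>,
  the element \<open>c = b n\<close> satisfies \<open>c\<^sup>* c \<le> 0\<close>, which forces \<open>c = 0\<close> and then \<open>n = 0\<close>.\<close>

lemma norm_positive_star_mult:
  fixes b :: "'a::unital_cstar_algebra"
  shows "norm_positive (star b * b)"
proof -
  define a where "a = star b * b"
  have sa: "star a = a"
    by (simp add: a_def star_mult star_star)
  obtain h where h: "norm_positive h" "h * h = a * a"
    "\<forall>c. c * (a * a) = (a * a) * c \<longrightarrow> c * h = h * c"
    by (rule norm_positive_root[OF norm_positive_square[OF sa]])
  have ah: "a * h = h * a"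
    by (rule h(3)[rule_format]) (simp add: mult.assoc)
  define n where "n = h - a"
  have n: "star n = n"
    by (simp add: n_def star_diff norm_positive_star h(1) sa)
  have nh: "n * h = h * n"
    using ah by (simp add: n_def algebra_simps)
  have na: "n * a = - (n * h)"
    using ah h(2) by (simp add: n_def algebra_simps)
  have pos: "norm_positive (n * h * n)"
    by (intro norm_positive_mult_square n h(1) nh)
  have "star (b * n) * (b * n) = n * a * n"
    by (simp add: a_def star_mult n mult.assoc)
  then have e: "star (b * n) * (b * n) = - (n * h * n)"
    by (simp add: na)
  then have "b * n = 0"
    using pos by (intro negative_star_mult_zero) simp
  then have "n * h * n = 0"
    using e by simp
  moreover from this have "n * a * n = 0"
    by (simp add: na)
  ultimately have "n * (h - a) * n = 0"
    by (simp add: algebra_simps)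
  then have "n = 0"
    using self_adjoint_cube_zero[OF n] by (simp flip: n_def)
  then show ?thesis
    using h(1) by (simp add: n_def flip: a_def)
qed

lemma cstar_positive_iff: "cstar_positive p \<longleftrightarrow> norm_positive p"
proof
  assume "norm_positive p"
  then obtain s where "norm_positive s" "s * s = p"
    using norm_positive_root by metis
  then show "cstar_positive p"
    by (metis cstar_positive_def norm_positive_star)
qed (auto simp: cstar_positive_def norm_positive_star_mult)

lemma norm_positive_conjugate:
  "norm_positive p \<Longrightarrow> norm_positive (a * p * star a)"
proof -
  assume "norm_positive p"
  then obtain s where s: "norm_positive s" "s * s = p"
    using norm_positive_root by metis
  have "a * p * star a = star (s * star a) * (s * star a)"
    unfolding s(2)[symmetric]
    by (simp add: star_mult star_star norm_positive_star[OF s(1)] mult.assoc)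
  then show ?thesis
    using norm_positive_star_mult by metis
qed

lemma positive_sqrt_square:
  assumes "norm_positive p"
  shows "(positive_sqrt p)\<^sup>2 = p"
proof -
  obtain s where s: "norm_positive s" "s * s = p"
    using norm_positive_root[OF assms] by metis
  have "\<exists>!b. cstar_positive b \<and> b\<^sup>2 = p"
    using s norm_positive_root_unique
    by (intro ex1I[of _ s]) (auto simp: cstar_positive_iff power2_eq_square)
  from theI'[OF this] show ?thesis
    by (simp add: positive_sqrt_def)
qed

section \<open>Positive linear forms\<close>

text \<open>The condition on -1 is properness: every self-adjoint \<open>x\<close> satisfies
  \<open>x + t *\<^sub>R 1 \<in> Q\<close> for large \<open>t\<close>, so a cone containing -1 would
  contain all self-adjoint elements.\<close>

definition positivity_cone :: "'a::unital_cstar_algebra set \<Rightarrow> bool"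
  where "positivity_cone Q \<longleftrightarrow>
    (\<forall>x\<in>Q. star x = x) \<and> (\<forall>x\<in>Q. \<forall>y\<in>Q. x + y \<in> Q) \<and> (\<forall>x\<in>Q. \<forall>r\<ge>0. r *\<^sub>R x \<in> Q) \<and>
    Collect norm_positive \<subseteq> Q \<and> -1 \<notin> Q"

lemma positivity_coneD:
  assumes "positivity_cone Q"
  shows "x \<in> Q \<Longrightarrow> star x = x" "x \<in> Q \<Longrightarrow> y \<in> Q \<Longrightarrow> x + y \<in> Q"
    "x \<in> Q \<Longrightarrow> 0 \<le> r \<Longrightarrow> r *\<^sub>R x \<in> Q" "norm_positive x \<Longrightarrow> x \<in> Q" "-1 \<notin> Q"
  using assms by (auto simp: positivity_cone_def)

text \<open>If adjoining \<open>a\<close> produced -1 as \<open>q + s *\<^sub>R a\<close>, then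
  \<open>- a\<close> would be the multiple \<open>(1/s) *\<^sub>R (q + 1)\<close> of an element of
  \<open>Q\<close>.\<close>

lemma positivity_cone_extend:
  fixes a :: "'a::unital_cstar_algebra"
  assumes Q: "positivity_cone Q" and a: "star a = a" and na: "- a \<notin> Q"
  obtains R where "positivity_cone R" "Q \<subseteq> R" "a \<in> R"
proof
  define R where "R = {q + s *\<^sub>R a |q s. q \<in> Q \<and> 0 \<le> s}"
  have R: "q + s *\<^sub>R a \<in> R" if "q \<in> Q" "0 \<le> s" for q s
    using that by (auto simp: R_def)
  have zero: "0 \<in> Q"
    using positivity_coneD(4)[OF Q norm_positive_zero] .
  show sub: "Q \<subseteq> R"
  proof
    fix q assume "q \<in> Q"
    from R[OF this, of 0] show "q \<in> R" by simp
  qed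
  show "a \<in> R"
    using R[OF zero, of 1] by simp
  show "positivity_cone R"
    unfolding positivity_cone_def
  proof (intro conjI ballI allI impI)
    fix x assume "x \<in> R"
    then obtain q s where x: "x = q + s *\<^sub>R a" and q: "q \<in> Q" and s: "0 \<le> s"
      by (auto simp: R_def)
    show "star x = x"
      using positivity_coneD(1)[OF Q q] by (simp add: x star_add star_scaleR a)
    show "r *\<^sub>R x \<in> R" if "0 \<le> r" for r
      using R[OF positivity_coneD(3)[OF Q q that], of "r * s"] s that by (simp add: x scaleR_add_right)
    fix y assume "y \<in> R"
    then obtain q' s' where y: "y = q' + s' *\<^sub>R a" and q': "q' \<in> Q" and s': "0 \<le> s'"
      by (auto simp: R_def)
    show "x + y \<in> R"
      using R[OF positivity_coneD(2)[OF Q q q'], of "s + s'"] s s'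
      by (simp add: x y scaleR_add_left add_ac)
  next
    show "Collect norm_positive \<subseteq> R"
      using sub positivity_coneD(4)[OF Q] by auto
    show "-1 \<notin> R"
    proof
      assume "-1 \<in> R"
      then obtain q s where e: "-1 = q + s *\<^sub>R a" and q: "q \<in> Q" and s: "0 \<le> s"
        by (auto simp: R_def)
      have "s \<noteq> 0"
        using e q positivity_coneD(5)[OF Q] by auto
      have "s *\<^sub>R a = -1 - q"
        using e by simp
      then have eq: "q + 1 = s *\<^sub>R (- a)"
        by simp
      have "(1/s) *\<^sub>R (q + 1) \<in> Q"
        using s by (intro positivity_coneD(2,3,4)[OF Q] q norm_positive_one) simp
      also have "(1/s) *\<^sub>R (q + 1) = - a"
        unfolding eq using \<open>s \<noteq> 0\<close> by simp
      finally have "- a \<in> Q" .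
      with na show False ..
    qed
  qed
qed

text \<open>The Riesz extension is carried out on cones rather than on partial functionals: a
  maximal proper cone decides the sign of every self-adjoint element.\<close>

lemma maximal_positivity_cone:
  fixes Q :: "'a::unital_cstar_algebra set"
  assumes Q: "positivity_cone Q"
  obtains M where "positivity_cone M" "Q \<subseteq> M" "\<forall>x. star x = x \<longrightarrow> x \<in> M \<or> - x \<in> M"
proof -
  define F where "F = {R. positivity_cone R \<and> Q \<subseteq> R}"
  have "\<exists>M\<in>F. \<forall>X\<in>F. M \<subseteq> X \<longrightarrow> X = M"
  proof (rule subset_Zorn_nonempty)
    show "F \<noteq> {}"
      using Q by (auto simp: F_def)
    fix C assume C: "C \<noteq> {}" "subset.chain F C"
    then have cone: "positivity_cone X" "Q \<subseteq> X" if "X \<in> C" for X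
      using that by (auto simp: subset.chain_def F_def)
    have common: "\<exists>Z\<in>C. x \<in> Z \<and> y \<in> Z" if "x \<in> X" "X \<in> C" "y \<in> Y" "Y \<in> C" for x y X Y
    proof -
      have "X \<subseteq> Y \<or> Y \<subseteq> X"
        using C(2) that by (auto simp: subset_chain_def)
      with that show ?thesis by blast
    qed
    have "positivity_cone (\<Union>C)"
      unfolding positivity_cone_def
    proof (intro conjI ballI allI impI)
      fix x assume "x \<in> \<Union>C"
      then obtain X where X: "x \<in> X" "X \<in> C"
        by auto
      show "star x = x"
        using positivity_coneD(1)[OF cone(1)] X by auto
      show "r *\<^sub>R x \<in> \<Union>C" if "0 \<le> r" for r
        using positivity_coneD(3)[OF cone(1)] X that by auto
      fix y assume "y \<in> \<Union>C"
      then obtain Y where "y \<in> Y" "Y \<in> C"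
        by auto
      then obtain Z where "Z \<in> C" "x \<in> Z" "y \<in> Z"
        using common X by blast
      then show "x + y \<in> \<Union>C"
        using positivity_coneD(2)[OF cone(1)] by auto
    next
      show "Collect norm_positive \<subseteq> \<Union>C"
        using C(1) positivity_coneD(4)[OF cone(1)] by auto
      show "-1 \<notin> \<Union>C"
        using positivity_coneD(5)[OF cone(1)] by auto
    qed
    then show "\<Union>C \<in> F"
      using C(1) cone(2) by (auto simp: F_def)
  qed
  then obtain M where M: "positivity_cone M" "Q \<subseteq> M" and
    max: "\<And>X. positivity_cone X \<Longrightarrow> Q \<subseteq> X \<Longrightarrow> M \<subseteq> X \<Longrightarrow> X = M"
    by (auto simp: F_def)
  have "x \<in> M \<or> - x \<in> M" if x: "star x = x" for x
  proof (rule disjCI)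
    assume "- x \<notin> M"
    then obtain R where "positivity_cone R" "M \<subseteq> R" "x \<in> R"
      using positivity_cone_extend[OF M(1) x] by metis
    then show "x \<in> M"
      using max[of R] M(2) by auto
  qed
  then show ?thesis
    using that M by auto
qed

section \<open>The real functional of a total cone\<close>

text \<open>The Dedekind cut that \<open>x\<close> makes on the line of scalars, in the order whose
  positive elements are \<open>Q\<close>.\<close>

definition cone_functional :: "'a::unital_cstar_algebra set \<Rightarrow> 'a \<Rightarrow> real"
  where "cone_functional Q x = Sup {t. x - t *\<^sub>R 1 \<in> Q}"

context
  fixes Q :: "'a::unital_cstar_algebra set"
  assumes Q: "positivity_cone Q" and total: "\<forall>x. star x = x \<longrightarrow> x \<in> Q \<or> - x \<in> Q"
begin

lemma cone_scalar: "r *\<^sub>R 1 \<in> Q \<longleftrightarrow> 0 \<le> r"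
proof
  show "0 \<le> r \<Longrightarrow> r *\<^sub>R 1 \<in> Q"
    by (intro positivity_coneD[OF Q] norm_positive_one)
  assume r: "r *\<^sub>R 1 \<in> Q"
  show "0 \<le> r"
  proof (rule ccontr)
    assume "\<not> 0 \<le> r"
    then have "(- (1/r)) *\<^sub>R r *\<^sub>R 1 \<in> Q"
      by (intro positivity_coneD(3)[OF Q r]) simp
    with \<open>\<not> 0 \<le> r\<close> show False
      using positivity_coneD(5)[OF Q] by simp
  qed
qed

lemma cone_bounds_le:
  assumes "x - t *\<^sub>R 1 \<in> Q" "u *\<^sub>R 1 - x \<in> Q"
  shows "t \<le> u"
proof -
  have "(x - t *\<^sub>R 1) + (u *\<^sub>R 1 - x) = (u - t) *\<^sub>R 1"
    by (simp add: algebra_simps)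
  then have "(u - t) *\<^sub>R 1 \<in> Q"
    using positivity_coneD(2)[OF Q assms] by simp
  then show ?thesis
    by (simp only: cone_scalar diff_ge_0_iff_ge)
qed

lemma self_adjoint_cone_bounds:
  assumes x: "star x = x"
  shows "norm x *\<^sub>R 1 - x \<in> Q" "x - (- norm x) *\<^sub>R 1 \<in> Q"
proof -
  show "norm x *\<^sub>R 1 - x \<in> Q"
    by (intro positivity_coneD(4)[OF Q] self_adjoint_upper x) simp
  have "norm x *\<^sub>R 1 - (- x) \<in> Q"
    by (intro positivity_coneD(4)[OF Q] self_adjoint_upper) (simp_all add: x star_minus)
  then show "x - (- norm x) *\<^sub>R 1 \<in> Q"
    by (simp add: add.commute)
qed

lemma bdd_above_cone: "star x = x \<Longrightarrow> bdd_above {t. x - t *\<^sub>R 1 \<in> Q}"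
  using cone_bounds_le[OF _ self_adjoint_cone_bounds(1)] by (auto intro!: bdd_aboveI)

lemma cone_functional_ge:
  assumes "star x = x" "x - t *\<^sub>R 1 \<in> Q"
  shows "t \<le> cone_functional Q x"
  unfolding cone_functional_def using assms by (intro cSup_upper bdd_above_cone) auto

lemma cone_functional_le:
  assumes "star x = x" "t *\<^sub>R 1 - x \<in> Q"
  shows "cone_functional Q x \<le> t"
  unfolding cone_functional_def
  by (rule cSup_least) (use self_adjoint_cone_bounds(2) cone_bounds_le assms in blast)+

text \<open>Totality turns the supremum into a two-sided estimate. The margin \<open>e\<close>
  remains because \<open>Q\<close> is not known to be closed.\<close>

lemma cone_functional_approx:
  assumes x: "star x = x" and e: "0 < e"
  shows "x - (cone_functional Q x - e) *\<^sub>R 1 \<in> Q" "(cone_functional Q x + e) *\<^sub>R 1 - x \<in> Q"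
proof -
  have sa: "star (x - t *\<^sub>R 1) = x - t *\<^sub>R 1" for t
    by (simp add: star_diff star_scaleR x)
  show "x - (cone_functional Q x - e) *\<^sub>R 1 \<in> Q"
  proof (rule ccontr)
    assume "\<not> ?thesis"
    then have "- (x - (cone_functional Q x - e) *\<^sub>R 1) \<in> Q"
      using total sa by blast
    then have "cone_functional Q x \<le> cone_functional Q x - e"
      by (intro cone_functional_le x) simp
    with e show False by simp
  qed
  show "(cone_functional Q x + e) *\<^sub>R 1 - x \<in> Q"
  proof (rule ccontr)
    assume n: "\<not> ?thesis"
    have "- (x - (cone_functional Q x + e) *\<^sub>R 1) \<notin> Q"
      using n by simp
    then have "x - (cone_functional Q x + e) *\<^sub>R 1 \<in> Q"
      using total sa by blast
    then have "cone_functional Q x + e \<le> cone_functional Q x"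
      by (intro cone_functional_ge x)
    with e show False by simp
  qed
qed

lemma cone_functional_add:
  assumes x: "star x = x" and y: "star y = y"
  shows "cone_functional Q (x + y) = cone_functional Q x + cone_functional Q y"
proof (rule antisym)
  have xy: "star (x + y) = x + y"
    by (simp add: star_add x y)
  let ?f = "cone_functional Q"
  show "?f (x + y) \<le> ?f x + ?f y"
  proof (rule field_le_epsilon)
    fix e :: real assume "0 < e"
    then have "((?f x + e/2) *\<^sub>R 1 - x) + ((?f y + e/2) *\<^sub>R 1 - y) \<in> Q"
      by (intro positivity_coneD(2)[OF Q] cone_functional_approx x y) auto
    also have "((?f x + e/2) *\<^sub>R 1 - x) + ((?f y + e/2) *\<^sub>R 1 - y)
        = ((?f x + e/2) + (?f y + e/2)) *\<^sub>R 1 - (x + y)"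
      by (simp only: scaleR_add_left) simp
    finally show "?f (x + y) \<le> ?f x + ?f y + e"
      using cone_functional_le[OF xy] by fastforce
  qed
  show "?f x + ?f y \<le> ?f (x + y)"
  proof (rule field_le_epsilon)
    fix e :: real assume "0 < e"
    then have "(x - (?f x - e/2) *\<^sub>R 1) + (y - (?f y - e/2) *\<^sub>R 1) \<in> Q"
      by (intro positivity_coneD(2)[OF Q] cone_functional_approx x y) auto
    also have "(x - (?f x - e/2) *\<^sub>R 1) + (y - (?f y - e/2) *\<^sub>R 1)
        = (x + y) - ((?f x - e/2) + (?f y - e/2)) *\<^sub>R 1"
      by (simp only: scaleR_add_left) simp
    finally show "?f x + ?f y \<le> ?f (x + y) + e"
      using cone_functional_ge[OF xy] by fastforce
  qed
qed

lemma cone_functional_scaleR_pos: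
  assumes x: "star x = x" and r: "0 < r"
  shows "cone_functional Q (r *\<^sub>R x) = r * cone_functional Q x"
proof (rule antisym)
  have rx: "star (r *\<^sub>R x) = r *\<^sub>R x"
    by (simp add: star_scaleR x)
  let ?f = "cone_functional Q"
  show "?f (r *\<^sub>R x) \<le> r * ?f x"
  proof (rule field_le_epsilon)
    fix e :: real assume "0 < e"
    then have "r *\<^sub>R ((?f x + e/r) *\<^sub>R 1 - x) \<in> Q"
      using r by (intro positivity_coneD(3)[OF Q] cone_functional_approx x) auto
    moreover have "r *\<^sub>R ((?f x + e/r) *\<^sub>R 1 - x) = (r * ?f x + e) *\<^sub>R 1 - r *\<^sub>R x"
      using r by (simp add: scaleR_diff_right distrib_left)
    ultimately show "?f (r *\<^sub>R x) \<le> r * ?f x + e"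
      using cone_functional_le[OF rx] by simp
  qed
  show "r * ?f x \<le> ?f (r *\<^sub>R x)"
  proof (rule field_le_epsilon)
    fix e :: real assume "0 < e"
    then have "r *\<^sub>R (x - (?f x - e/r) *\<^sub>R 1) \<in> Q"
      using r by (intro positivity_coneD(3)[OF Q] cone_functional_approx x) auto
    moreover have "r *\<^sub>R (x - (?f x - e/r) *\<^sub>R 1) = r *\<^sub>R x - (r * ?f x - e) *\<^sub>R 1"
      using r by (simp add: scaleR_diff_right right_diff_distrib)
    ultimately have "r * ?f x - e \<le> ?f (r *\<^sub>R x)"
      using cone_functional_ge[OF rx] by simp
    then show "r * ?f x \<le> ?f (r *\<^sub>R x) + e"
      by simp
  qed
qed

lemma cone_functional_zero: "cone_functional Q 0 = 0"
  using cone_functional_add[of 0 0] by simp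

lemma cone_functional_minus: "star x = x \<Longrightarrow> cone_functional Q (- x) = - cone_functional Q x"
  using cone_functional_add[of x "- x"] cone_functional_zero by (simp add: star_minus)

lemma cone_functional_scaleR:
  assumes x: "star x = x"
  shows "cone_functional Q (r *\<^sub>R x) = r * cone_functional Q x"
proof -
  consider "0 < r" | "r = 0" | "0 < - r"
    by linarith
  then show ?thesis
  proof cases
    case 3
    have "cone_functional Q (- ((- r) *\<^sub>R x)) = - (- r * cone_functional Q x)"
      using 3 x by (subst cone_functional_minus) (simp_all add: star_scaleR cone_functional_scaleR_pos del: scaleR_minus_left)
    then show ?thesis
      by simp
  qed (use x cone_functional_scaleR_pos cone_functional_zero in auto)
qed

lemma cone_functional_one: "cone_functional Q 1 = 1"
proof (rule antisym)
  have "0 \<in> Q"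
    by (intro positivity_coneD(4)[OF Q] norm_positive_zero)
  then show "cone_functional Q 1 \<le> 1" "1 \<le> cone_functional Q 1"
    by (intro cone_functional_le cone_functional_ge; simp)+
qed

end

section \<open>Complex linear forms and strict positivity\<close>

lemma scaleC_minus_left: "(- c) *\<^sub>C a = - (c *\<^sub>C (a::'a::unital_cstar_algebra))"
  using scaleC_add_left[of "- c" c a] scaleR_scaleC[of 0 a] by (simp add: eq_neg_iff_add_eq_0)

lemma scaleC_minus_right: "c *\<^sub>C (- a) = - (c *\<^sub>C (a::'a::unital_cstar_algebra))"
  using scaleC_add_right[of c "- a" a] scaleC_add_right[of c 0 "0::'a"]
  by (simp add: eq_neg_iff_add_eq_0)

lemma scaleC_diff_right: "c *\<^sub>C (a - b) = c *\<^sub>C a - c *\<^sub>C (b::'a::unital_cstar_algebra)"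
  using scaleC_add_right[of c a "- b"] by (simp add: scaleC_minus_right)

lemma vector_space_scaleC: "vector_space ((*\<^sub>C) :: complex \<Rightarrow> 'a \<Rightarrow> 'a::unital_cstar_algebra)"
  by standard (simp_all add: scaleC_add_right scaleC_add_left scaleC_scaleC scaleC_one)

definition re_part :: "'a::unital_cstar_algebra \<Rightarrow> 'a"
  where "re_part a = (1/2) *\<^sub>R (a + star a)"

definition im_part :: "'a::unital_cstar_algebra \<Rightarrow> 'a"
  where "im_part a = (- \<i>/2) *\<^sub>C (a - star a)"

lemma star_re_part: "star (re_part a) = re_part a"
  by (simp add: re_part_def star_scaleR star_add star_star add.commute)

lemma star_im_part: "star (im_part a) = im_part a"
  by (simp add: im_part_def star_scaleC star_diff star_star scaleC_diff_right scaleC_minus_left)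

lemma re_im_part: "a = re_part a + \<i> *\<^sub>C im_part a"
proof -
  have "\<i> *\<^sub>C im_part a = (1/2) *\<^sub>R (a - star a)"
    by (simp add: im_part_def scaleC_scaleC scaleR_scaleC)
  then have "re_part a + \<i> *\<^sub>C im_part a = (1/2) *\<^sub>R ((a + star a) + (a - star a))"
    by (simp only: re_part_def scaleR_add_right)
  also have "(a + star a) + (a - star a) = 2 *\<^sub>R a"
    by (simp add: scaleR_2)
  finally show ?thesis
    by simp
qed

lemma re_im_part_self_adjoint:
  assumes "star a = a"
  shows "re_part a = a" "im_part a = 0"
  using assms scaleC_diff_right[of "- \<i>/2" a a] by (simp_all add: re_part_def im_part_def flip: scaleR_2)

lemma re_im_part_add:
  "re_part (a + b) = re_part a + re_part b" "im_part (a + b) = im_part a + im_part b"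
  by (simp_all add: re_part_def im_part_def star_add scaleR_add_right scaleC_diff_right
      scaleC_add_right algebra_simps)

lemma re_im_part_scaleR:
  fixes a :: "'a::unital_cstar_algebra"
  shows
  "re_part (r *\<^sub>R a) = r *\<^sub>R re_part a" "im_part (r *\<^sub>R a) = r *\<^sub>R im_part a"
proof -
  show "re_part (r *\<^sub>R a) = r *\<^sub>R re_part a"
    by (simp add: re_part_def star_scaleR scaleR_add_right)
  have "w *\<^sub>C (r *\<^sub>R b) = r *\<^sub>R (w *\<^sub>C b)" for w and b :: 'a
    by (simp add: scaleR_scaleC scaleC_scaleC mult.commute)
  then show "im_part (r *\<^sub>R a) = r *\<^sub>R im_part a"
    by (simp add: im_part_def star_scaleR flip: scaleR_diff_right)
qed

lemma re_im_part_imaginary: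
  "re_part (\<i> *\<^sub>C a) = - im_part a" "im_part (\<i> *\<^sub>C a) = re_part a"
  by (simp_all add: re_part_def im_part_def star_scaleC scaleR_add_right scaleC_diff_right
      scaleR_scaleC scaleC_scaleC scaleC_add_right scaleC_minus_left scaleC_minus_right)

text \<open>Since \<open>y\<close> is not positive, \<open>- y\<close> can be adjoined to the
  positive cone; the functional of a total extension is then at most 0 at \<open>y\<close>. The
  value 1 at 1 certifies that the form is nonzero.\<close>

lemma positive_linear_form_separation:
  fixes y :: "'a::unital_cstar_algebra"
  assumes y: "star y = y" and np: "\<not> norm_positive y"
  obtains F :: "'a \<Rightarrow> complex"
  where "positive_linear_form F" "F 1 = 1" "\<forall>x. star x = x \<longrightarrow> F x \<in> \<real>" "Re (F y) \<le> 0"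
proof -
  \<comment> \<open>In the zero algebra -1 equals 0 and would lie in the positive cone; the
    existence of a non-positive element excludes this case.\<close>
  have one: "(1::'a) \<noteq> 0"
  proof
    assume "(1::'a) = 0"
    then have "y = 0"
      by (metis mult_1 mult_zero_left)
    with np norm_positive_zero[where 'a='a] show False by simp
  qed
  have "positivity_cone (Collect norm_positive :: 'a set)"
    unfolding positivity_cone_def
    using norm_positive_antisym[OF norm_positive_one, where 'a='a] one
    by (auto simp: norm_positive_star norm_positive_add norm_positive_scaleR)
  then obtain R where R: "positivity_cone R" "- y \<in> R"
    using positivity_cone_extend[of "Collect norm_positive" "- y"] y np by (auto simp: star_minus)
  obtain Q where Q: "positivity_cone Q" "R \<subseteq> Q" and total: "\<forall>x. star x = x \<longrightarrow> x \<in> Q \<or> - x \<in> Q"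
    by (rule maximal_positivity_cone[OF R(1)])
  let ?f = "cone_functional Q"
  note f = cone_functional_add[OF Q(1) total] cone_functional_scaleR[OF Q(1) total]
    cone_functional_minus[OF Q(1) total] cone_functional_one[OF Q(1) total]
    cone_functional_zero[OF Q(1) total]
  define F where "F a = Complex (?f (re_part a)) (?f (im_part a))" for a
  have Fadd: "F (a + b) = F a + F b" for a b
    by (simp add: F_def re_im_part_add f star_re_part star_im_part complex_eq_iff)
  have FR: "F (r *\<^sub>R a) = of_real r * F a" for r a
    by (simp add: F_def re_im_part_scaleR f star_re_part star_im_part complex_eq_iff)
  have Fi: "F (\<i> *\<^sub>C a) = \<i> * F a" for a
    by (simp add: F_def re_im_part_imaginary f star_re_part star_im_part complex_eq_iff)
  have FC: "F (c *\<^sub>C a) = c * F a" for c a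
  proof -
    have "c *\<^sub>C a = Re c *\<^sub>R a + \<i> *\<^sub>C (Im c *\<^sub>R a)"
      using complex_eq[of c] by (simp add: scaleR_scaleC scaleC_scaleC flip: scaleC_add_left)
    then have "F (c *\<^sub>C a) = (of_real (Re c) + \<i> * of_real (Im c)) * F a"
      by (simp add: Fadd FR Fi algebra_simps)
    then show ?thesis
      using complex_eq[of c] by simp
  qed
  have lin: "Vector_Spaces.linear (*\<^sub>C) (*) F"
  proof -
    interpret A: vector_space "(*\<^sub>C) :: complex \<Rightarrow> 'a \<Rightarrow> 'a"
      by (rule vector_space_scaleC)
    interpret C: vector_space "(*) :: complex \<Rightarrow> complex \<Rightarrow> complex"
      by standard (simp_all add: algebra_simps)
    show ?thesis
      by unfold_locales (simp_all add: Fadd FC)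
  qed
  have Fsa: "F x = of_real (?f x)" if "star x = x" for x
    using that by (simp add: F_def re_im_part_self_adjoint f complex_eq_iff)
  have "F a \<in> \<real>\<^sub>\<ge>\<^sub>0" if "cstar_positive a" for a
  proof -
    have a: "norm_positive a"
      using that by (simp add: cstar_positive_iff)
    have "0 \<le> ?f a"
      by (intro cone_functional_ge[OF Q(1) total] norm_positive_star a)
        (simp add: positivity_coneD(4)[OF Q(1) a])
    then show ?thesis
      by (simp add: Fsa norm_positive_star a)
  qed
  with lin have "positive_linear_form F"
    by (simp add: positive_linear_form_def)
  moreover have "F 1 = 1"
    by (simp add: Fsa f)
  moreover have "\<forall>x. star x = x \<longrightarrow> F x \<in> \<real>"
    by (simp add: Fsa)
  moreover have "Re (F y) \<le> 0"
  proof -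
    have "?f y \<le> 0"
      by (intro cone_functional_le[OF Q(1) total] y) (use R(2) Q(2) in auto)
    then show ?thesis
      by (simp add: Fsa y)
  qed
  ultimately show ?thesis
    by (rule that)
qed

lemma positive_linear_form_linear:
  assumes "positive_linear_form f"
  shows "f (a + b) = f a + f b" "f (c *\<^sub>C a) = c * f a" "f (r *\<^sub>R a) = of_real r * f a"
    "f (a - b) = f a - f b"
proof -
  interpret Vector_Spaces.linear "(*\<^sub>C)" "(*)" f
    using assms by (simp add: positive_linear_form_def)
  show "f (a + b) = f a + f b" "f (c *\<^sub>C a) = c * f a" "f (r *\<^sub>R a) = of_real r * f a"
    "f (a - b) = f a - f b"
    by (simp_all add: add scale diff scaleR_scaleC)
qed

text \<open>Self-adjointness comes first. On a separating form \<open>F\<close>, the value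
  \<open>F a\<close> is real, which forces \<open>F ?k = 0\<close> for the imaginary part
  \<open>?k\<close>. Hence \<open>r *\<^sub>R ?k + e *\<^sub>R 1\<close> has the value
  \<open>e > 0\<close> and cannot be separated from the cone; taking both signs of \<open>r\<close>
  and letting \<open>e\<close> tend to 0 gives \<open>?k = 0\<close>.\<close>

lemma strictly_positive_imp_norm_positive:
  fixes a :: "'a::unital_cstar_algebra"
  assumes a: "strictly_positive a"
  shows "norm_positive a"
proof -
  let ?h = "re_part a" and ?k = "im_part a"
  have eps: "norm_positive (r *\<^sub>R ?k + e *\<^sub>R 1)" if e: "0 < e" for r e
  proof (rule ccontr)
    assume n: "\<not> norm_positive (r *\<^sub>R ?k + e *\<^sub>R 1)"
    have "star (r *\<^sub>R ?k + e *\<^sub>R 1) = r *\<^sub>R ?k + e *\<^sub>R 1"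
      by (simp add: star_add star_scaleR star_im_part)
    then obtain F where F: "positive_linear_form F" "F 1 = 1" "\<forall>x. star x = x \<longrightarrow> F x \<in> \<real>"
      "Re (F (r *\<^sub>R ?k + e *\<^sub>R 1)) \<le> 0"
      using n by (rule positive_linear_form_separation)
    have "F a \<in> \<real>"
      using a F(1,2) unfolding strictly_positive_def by (metis zero_neq_one)
    moreover have "F a = F ?h + \<i> * F ?k"
      using re_im_part[of a] positive_linear_form_linear(1,2)[OF F(1)] by metis
    moreover have "F ?h \<in> \<real>" "F ?k \<in> \<real>"
      using F(3) star_re_part star_im_part by auto
    ultimately have "F ?k = 0"
      by (auto simp: complex_is_Real_iff complex_eq_iff)
    then have "Re (F (r *\<^sub>R ?k + e *\<^sub>R 1)) = e"
      by (simp add: positive_linear_form_linear[OF F(1)] F(2))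
    with F(4) e show False by simp
  qed
  have "norm_positive (1 *\<^sub>R ?k)" "norm_positive ((-1) *\<^sub>R ?k)"
    by (rule norm_positive_eps[OF eps], assumption)+
  then have "?k = 0"
    using norm_positive_antisym[of ?k] by simp
  then have "a = ?h"
    using re_im_part[of a] scaleC_diff_right[of \<i> ?k ?k] by simp
  then have sa: "star a = a"
    using star_re_part[of a] by simp
  show ?thesis
  proof (rule ccontr)
    assume "\<not> norm_positive a"
    with sa obtain F where F: "positive_linear_form F" "F 1 = 1" "\<forall>x. star x = x \<longrightarrow> F x \<in> \<real>"
      "Re (F a) \<le> 0"
      by (rule positive_linear_form_separation)
    then have "0 < Re (F a)"
      using a unfolding strictly_positive_def by (metis zero_neq_one)
    with F(4) show False
      by simp
  qed
qed

text \<open>A positive form vanishing at 1 vanishes on each self-adjoint \<open>x\<close>, which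
  lies between the multiples of 1 by \<open>- norm x\<close> and \<open>norm x\<close>.\<close>

lemma strictly_positive_one: "strictly_positive (1::'a::unital_cstar_algebra)"
  unfolding strictly_positive_def
proof (intro allI impI, elim conjE exE)
  fix f :: "'a \<Rightarrow> complex" and b
  assume f: "positive_linear_form f" and b: "f b \<noteq> 0"
  have pos: "f p \<in> \<real>\<^sub>\<ge>\<^sub>0" if "norm_positive p" for p
    using f that by (simp add: positive_linear_form_def cstar_positive_iff)
  have one: "f 1 \<in> \<real>\<^sub>\<ge>\<^sub>0"
    by (rule pos[OF norm_positive_one])
  have "f 1 \<noteq> 0"
  proof
    assume 1: "f 1 = 0"
    have "f x = 0" if x: "star x = x" for x
    proof -
      have "f (norm x *\<^sub>R 1 - x) \<in> \<real>\<^sub>\<ge>\<^sub>0" "f (norm x *\<^sub>R 1 - (- x)) \<in> \<real>\<^sub>\<ge>\<^sub>0"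
        by (rule pos, rule self_adjoint_upper; simp add: x star_minus)+
      moreover have "f (- x) = - f x"
        using positive_linear_form_linear(3)[OF f, of "-1" x] by simp
      ultimately show ?thesis
        by (simp add: positive_linear_form_linear(1,3,4)[OF f] 1 complex_nonneg_Reals_iff complex_eq_iff)
    qed
    then have "f (re_part b + \<i> *\<^sub>C im_part b) = 0"
      by (simp add: positive_linear_form_linear[OF f] star_re_part star_im_part)
    with b show False
      using re_im_part[of b] by simp
  qed
  with one show "f 1 \<in> \<real> \<and> 0 < Re (f 1)"
    by (auto simp: complex_nonneg_Reals_iff complex_is_Real_iff complex_eq_iff)
qed

lemma strictly_positive_add:
  fixes a b :: "'a::unital_cstar_algebra"
  assumes "strictly_positive a" "strictly_positive b"
  shows "strictly_positive (a + b)"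
  unfolding strictly_positive_def
proof (intro allI impI, elim conjE)
  fix f :: "'a \<Rightarrow> complex"
  assume f: "positive_linear_form f" "\<exists>b. f b \<noteq> 0"
  then have "f a \<in> \<real> \<and> Re (f a) > 0" "f b \<in> \<real> \<and> Re (f b) > 0"
    using assms unfolding strictly_positive_def by blast+
  then show "f (a + b) \<in> \<real> \<and> Re (f (a + b)) > 0"
    by (simp add: positive_linear_form_linear[OF f(1)])
qed

lemma strictly_positive_scaleR:
  assumes "strictly_positive a" "0 < r"
  shows "strictly_positive (r *\<^sub>R a)"
  using assms by (auto simp: strictly_positive_def positive_linear_form_linear)

section \<open>Hilbert modules\<close>

text \<open>\<open>q\<close> plays the role of the inverse square root of
  \<open>p + e *\<^sub>R 1\<close>. That element is \<open>t *\<^sub>R (1 - X)\<close> with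
  \<open>norm X < 1\<close>, so Banach's fixed point theorem, in place of a Neumann series, inverts
  it.\<close>

lemma norm_positive_inverse_root:
  fixes p :: "'a::unital_cstar_algebra"
  assumes p: "norm_positive p" and e: "0 < e"
  obtains s q where "star s = s" "star q = q" "s * s = p + e *\<^sub>R 1" "s * q = 1" "q * s = 1"
proof -
  define t where "t = norm p + e"
  have t: "0 < t"
    using e by (simp add: t_def add_nonneg_pos)
  define X where "X = (1/t) *\<^sub>R (norm p *\<^sub>R 1 - p)"
  have X: "norm X \<le> norm p / t"
    using norm_positive_norm_bound[OF p order.refl] t by (simp add: X_def divide_right_mono)
  have "\<exists>!y. 1 + X * y = y"
  proof (rule banach_fix_type[of "norm p / t"])
    show "0 \<le> norm p / t" "norm p / t < 1"
      using t e by (auto simp: t_def)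
    show "\<forall>x y. dist (1 + X * x) (1 + X * y) \<le> norm p / t * dist x y"
    proof (intro allI)
      fix x y
      have "dist (1 + X * x) (1 + X * y) = norm (X * (x - y))"
        by (simp add: dist_norm right_diff_distrib)
      also have "\<dots> \<le> norm X * norm (x - y)"
        by (rule norm_mult_ineq)
      also have "\<dots> \<le> norm p / t * norm (x - y)"
        using X by (rule mult_right_mono) simp
      finally show "dist (1 + X * x) (1 + X * y) \<le> norm p / t * dist x y"
        by (simp add: dist_norm)
    qed
  qed
  then obtain y where y: "1 + X * y = y"
    by blast
  define P where "P = p + e *\<^sub>R 1"
  have "1 - X = (1/t) *\<^sub>R (t *\<^sub>R 1) - X"
    using t by simp
  also have "\<dots> = (1/t) *\<^sub>R P"
    unfolding X_def P_def t_def by (simp add: scaleR_add_left flip: scaleR_diff_right)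
  finally have PX: "1 - X = (1/t) *\<^sub>R P" .
  define w where "w = (1/t) *\<^sub>R y"
  have "(1 - X) * y = 1"
    using y by (metis add_diff_cancel_right' left_diff_distrib mult_1)
  then have Pw: "P * w = 1"
    by (simp add: PX w_def)
  have sP: "star P = P"
    by (simp add: P_def star_add star_scaleR norm_positive_star p)
  then have wP: "star w * P = 1"
    using arg_cong[OF Pw, of star] by (simp add: star_mult)
  have sw: "star w = w"
    using Pw wP by (metis mult.assoc mult_1 mult_1_right)
  have "norm_positive P"
    unfolding P_def using e by (intro norm_positive_add p norm_positive_scaleR norm_positive_one) simp
  then obtain s where s: "norm_positive s" "s * s = P"
    using norm_positive_root by metis
  have ss: "star s = s"
    using s by (simp add: norm_positive_star)
  have 1: "w * s * s = 1" "s * (s * w) = 1"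
    using Pw wP sw s(2) by (simp_all add: mult.assoc flip: mult.assoc[of s s w])
  \<comment> \<open>\<open>w * s\<close> is a left inverse and \<open>s * w\<close> a right inverse
    of \<open>s\<close>, so they coincide.\<close>
  then have q: "w * s = s * w"
    by (metis mult.assoc mult_1 mult_1_right)
  show ?thesis
  proof (rule that[of s "w * s"])
    show "star (w * s) = w * s"
      using q by (simp add: star_mult ss sw)
    show "s * s = p + e *\<^sub>R 1"
      using s(2) by (simp add: P_def)
    show "s * (w * s) = 1"
      using 1(2) q by simp
  qed (use ss 1 in auto)
qed

context hilbert_module
begin

lemma ip_norm_positive: "norm_positive (ip x x)"
  using ip_positive by (simp add: cstar_positive_iff)

lemma module_abs_square: "(module_abs ip x)\<^sup>2 = ip x x"
  unfolding module_abs_def by (rule positive_sqrt_square[OF ip_norm_positive])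

lemma ip_act_right: "ip x (act a y) = ip x y * star a"
  by (metis ip_act_left ip_star star_mult)

lemma ip_act_act: "ip (act a x) (act a x) = a * ip x x * star a"
  by (simp add: ip_act_left ip_act_right mult.assoc)

lemma act_minus_one: "act (- 1) x = - x"
  using act_scaleR[of "-1" x] by simp

lemma ip_diff_left: "ip (x - y) z = ip x z - ip y z"
  using ip_add_left[of "x - y" y z] by simp

lemma act_diff_right: "act a (x - y) = act a x - act a y"
  using act_add_right[of a "x - y" y] by simp

lemma orth_projection_unique:
  assumes K: "orthogonally_complemented act ip K"
    and y: "y \<in> K" "x - y \<in> orth_complement ip K" and z: "z \<in> K" "x - z \<in> orth_complement ip K"
  shows "y = z"
proof -
  have "y + act (-1) z \<in> K"
    using K y(1) z(1) by (auto simp: orthogonally_complemented_def is_submodule_def)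
  then have "y - z \<in> K"
    by (simp add: act_minus_one)
  moreover have "y - z \<in> orth_complement ip K"
    using y(2) z(2) by (auto simp: orth_complement_def ip_diff_left)
  ultimately have "y - z \<in> {0}"
    using K unfolding orthogonally_complemented_def by blast
  then show ?thesis
    by simp
qed

lemma orth_projection_works:
  assumes K: "orthogonally_complemented act ip K"
  shows "orth_projection ip K x \<in> K \<and> x - orth_projection ip K x \<in> orth_complement ip K"
proof -
  have "x \<in> {u + v |u v. u \<in> K \<and> v \<in> orth_complement ip K}"
    using K by (simp add: orthogonally_complemented_def)
  then obtain u v where "x = u + v" "u \<in> K" "v \<in> orth_complement ip K"
    by blast
  then have "u \<in> K \<and> x - u \<in> orth_complement ip K"
    by simp
  then have "\<exists>!y. y \<in> K \<and> x - y \<in> orth_complement ip K"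
    using orth_projection_unique[OF K] by blast
  then show ?thesis
    unfolding orth_projection_def by (rule theI')
qed

lemma orth_projection_act:
  assumes K: "orthogonally_complemented act ip K"
  shows "orth_projection ip K (act a x) = act a (orth_projection ip K x)"
proof (rule orth_projection_unique[OF K])
  let ?y = "orth_projection ip K x"
  have y: "?y \<in> K" "x - ?y \<in> orth_complement ip K"
    using orth_projection_works[OF K] by auto
  show "act a ?y \<in> K"
    using K y(1) by (auto simp: orthogonally_complemented_def is_submodule_def)
  have "act a (x - ?y) \<in> orth_complement ip K"
    using y(2) by (auto simp: orth_complement_def ip_act_left)
  then show "act a x - act a ?y \<in> orth_complement ip K"
    by (simp add: act_diff_right)
qed (use orth_projection_works[OF K] in auto)

text \<open>Applying the bound to \<open>y = (|x|\<^sup>2 + e)\<^sup>-\<^sup>1\<^sup>/\<^sup>2 x\<close>, for which \<open>|y| \<le> 1\<close>, replaces the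
  algebra-valued bound by a scalar one. Bounds of the form \<open>|Bx|\<^sup>2\<close> cannot be added directly,
  since \<open>B\<close> is not central.\<close>

lemma quadratic_scalar_bound:
  assumes S: "\<And>a x. S (act a x) = a * S x * star a"
    and B: "\<And>x. norm_positive (B * ip x x * star B - S x)"
  shows "norm_positive ((norm B * norm B) *\<^sub>R ip x x - S x)"
proof (rule norm_positive_eps)
  fix e :: real assume e: "0 < e"
  let ?k = "norm B * norm B"
  obtain s q where s: "star s = s" "star q = q" "s * s = ip x x + e *\<^sub>R 1" "s * q = 1" "q * s = 1"
    by (rule norm_positive_inverse_root[OF ip_norm_positive e])
  define z where "z = q * ip x x * q"
  have "q * (s * s) * q = 1"
    using s(4,5) by (metis mult.assoc mult_1)
  then have "1 - z = q * (s * s) * q - z"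
    by simp
  also have "\<dots> = e *\<^sub>R (q * q)"
    by (simp add: s(3) z_def algebra_simps)
  finally have "norm_positive (1 - z)"
    using e s(2) by (simp add: norm_positive_scaleR norm_positive_square)
  then have "norm_positive (B * (1 - z) * star B)"
    by (rule norm_positive_conjugate)
  moreover have "norm_positive (?k *\<^sub>R 1 - B * star B)"
    using norm_mult_ineq[of B "star B"]
    by (intro self_adjoint_upper) (simp_all add: star_mult star_star norm_star)
  moreover have "norm_positive (B * z * star B - q * S x * q)"
    using B[of "act q x"] by (simp add: S ip_act_act s(2) z_def)
  ultimately have "norm_positive (B * (1 - z) * star B + (?k *\<^sub>R 1 - B * star B) + (B * z * star B - q * S x * q))"
    by (intro norm_positive_add)
  then have "norm_positive (?k *\<^sub>R 1 - q * S x * q)"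
    by (simp add: algebra_simps)
  \<comment> \<open>Conjugation by \<open>s\<close> undoes the one by \<open>q\<close>, but sends 1
    to \<open>ip x x + e *\<^sub>R 1\<close>; the surplus is a multiple of \<open>e\<close> and
    disappears in the limit.\<close>
  then have "norm_positive (s * (?k *\<^sub>R 1 - q * S x * q) * star s)"
    by (rule norm_positive_conjugate)
  moreover have "s * (q * S x * q) * s = S x"
    using s(4,5) by (metis mult.assoc mult_1 mult_1_right)
  ultimately have "norm_positive (?k *\<^sub>R (s * s) - S x)"
    by (simp add: s(1) right_diff_distrib left_diff_distrib)
  then show "norm_positive (?k *\<^sub>R ip x x - S x + e *\<^sub>R (?k *\<^sub>R 1))"
    by (simp add: s(3) algebra_simps)
qed

end

section \<open>Series of positive elements\<close>

lemma norm_positive_sum: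
  "(\<And>i. i \<in> I \<Longrightarrow> norm_positive (f i)) \<Longrightarrow> norm_positive (sum f I)"
  by (induction I rule: infinite_finite_induct) (auto intro: norm_positive_zero norm_positive_add)

lemma norm_positive_suminf:
  assumes "summable f" "\<And>n. norm_positive (f n)"
  shows "norm_positive (suminf f)"
  using summable_LIMSEQ[OF assms(1)] by (rule norm_positive_LIMSEQ) (intro norm_positive_sum assms(2))

lemma norm_positive_suminf_le:
  assumes "summable f" "summable g" "\<And>n. norm_positive (g n - f n)"
  shows "norm_positive (suminf g - suminf f)"
  using norm_positive_suminf[OF summable_diff[OF assms(2,1)] assms(3)] suminf_diff[OF assms(2,1)]
  by simp

text \<open>The norms of the terms of \<open>g\<close> may fail to be summable, so the order is
  applied to the blocks of the Cauchy criterion, where \<open>norm_positive_mono\<close> compares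
  norms.\<close>

lemma norm_positive_summable_comparison:
  fixes f g :: "nat \<Rightarrow> 'a::unital_cstar_algebra"
  assumes g: "summable g" and f: "\<And>n. norm_positive (f n)" and fg: "\<And>n. norm_positive (g n - f n)"
  shows "summable f"
  unfolding summable_Cauchy
proof (intro allI impI)
  fix e :: real assume "0 < e"
  then obtain N where N: "\<And>m n. N \<le> m \<Longrightarrow> norm (sum g {m..<n}) < e"
    using g unfolding summable_Cauchy by meson
  have "norm (sum f {m..<n}) \<le> norm (sum g {m..<n})" for m n
    by (intro norm_positive_mono norm_positive_sum f)
      (simp add: norm_positive_sum fg flip: sum_subtractf)
  then show "\<exists>N. \<forall>m\<ge>N. \<forall>n. norm (sum f {m..<n}) < e"
    using N order_le_less_trans by blast
qed

section \<open>Sums of frame weights\<close>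

lemma central_norm_positive_mult:
  assumes a: "central a" "norm_positive a" and p: "norm_positive p"
  shows "norm_positive (a * p)"
proof -
  obtain s where s: "norm_positive s" "s * s = a" "\<forall>c. c * a = a * c \<longrightarrow> c * s = s * c"
    by (rule norm_positive_root[OF a(2)])
  have "p * s = s * p"
    using s(3) a(1) by (metis central_def)
  then have "a * p = s * p * star s"
    using norm_positive_star[OF s(1)] s(2) by (metis mult.assoc)
  then show ?thesis
    using norm_positive_conjugate[OF p] by simp
qed

text \<open>The first element is \<open>2 *\<^sub>R (a * (b * p)) + b * (b * p)\<close>; the second
  is \<open>p\<close> conjugated by \<open>a - b\<close>.\<close>

lemma weight_square_sum_bounds:
  fixes a b p :: "'a::unital_cstar_algebra"
  assumes a: "central a" "norm_positive a" and b: "central b" "norm_positive b"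
    and p: "norm_positive p"
  shows "norm_positive ((a + b)\<^sup>2 * p - a\<^sup>2 * p)"
    and "norm_positive (2 *\<^sub>R (a\<^sup>2 * p) + 2 *\<^sub>R (b\<^sup>2 * p) - (a + b)\<^sup>2 * p)"
proof -
  note mult = central_norm_positive_mult
  have ab: "b * a = a * b"
    using b(1) by (simp add: central_def)
  have "norm_positive (2 *\<^sub>R (a * (b * p)) + b * (b * p))"
    by (intro norm_positive_add norm_positive_scaleR mult a b p) simp
  also have "2 *\<^sub>R (a * (b * p)) + b * (b * p) = (a + b)\<^sup>2 * p - a\<^sup>2 * p"
    using ab by (simp add: power2_eq_square algebra_simps scaleR_2 flip: mult.assoc)
  finally show "norm_positive ((a + b)\<^sup>2 * p - a\<^sup>2 * p)" .
  have d: "star (a - b) = a - b"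
    by (simp add: star_diff norm_positive_star a b)
  have "p * (a - b) = (a - b) * p"
    using a(1) b(1) by (simp add: central_def algebra_simps)
  then have "(a - b) * p * star (a - b) = (a - b) * (a - b) * p"
    by (simp add: d mult.assoc)
  also have "\<dots> = 2 *\<^sub>R (a\<^sup>2 * p) + 2 *\<^sub>R (b\<^sup>2 * p) - (a + b)\<^sup>2 * p"
    using ab by (simp add: power2_eq_square algebra_simps scaleR_2)
  finally show "norm_positive (2 *\<^sub>R (a\<^sup>2 * p) + 2 *\<^sub>R (b\<^sup>2 * p) - (a + b)\<^sup>2 * p)"
    using norm_positive_conjugate[OF p, of "a - b"] by simp
qed

lemma weight_add:
  fixes \<alpha> \<beta> :: "nat \<Rightarrow> 'a::unital_cstar_algebra"
  assumes "weight \<alpha>" "weight \<beta>"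
  shows "weight (\<lambda>n. \<alpha> n + \<beta> n)"
  using assms by (auto simp: weight_def central_def strictly_positive_add distrib_left distrib_right)

lemma weight_scaleR: "weight \<alpha> \<Longrightarrow> 0 < r \<Longrightarrow> weight (\<lambda>n. r *\<^sub>R \<alpha> n)"
  by (auto simp: weight_def central_def strictly_positive_scaleR)

locale complemented_sequence = hilbert_module act ip
  for act :: "'a::unital_cstar_algebra \<Rightarrow> 'h::banach \<Rightarrow> 'h" and ip :: "'h \<Rightarrow> 'h \<Rightarrow> 'a" +
  fixes K :: "nat \<Rightarrow> 'h set"
  assumes complemented: "\<And>n. orthogonally_complemented act ip (K n)"
begin

definition frame_term :: "(nat \<Rightarrow> 'a) \<Rightarrow> 'h \<Rightarrow> nat \<Rightarrow> 'a"
  where "frame_term \<omega> x n =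
    (\<omega> n)\<^sup>2 * ip (orth_projection ip (K n) x) (orth_projection ip (K n) x)"

lemma star_fusion_frame_iff:
  "star_fusion_frame act ip K \<omega> \<longleftrightarrow> (\<forall>x. summable (frame_term \<omega> x)) \<and>
    (\<exists>A B. strictly_positive A \<and> strictly_positive B \<and>
      (\<forall>x. norm_positive (suminf (frame_term \<omega> x) - A * ip x x * star A) \<and>
           norm_positive (B * ip x x * star B - suminf (frame_term \<omega> x))))"
  by (simp add: star_fusion_frame_def cstar_le_def cstar_positive_iff module_abs_square ip_act_act
      frame_term_def[abs_def])

text \<open>Projections commute with the action, and central weights let \<open>a\<close> move out
  to the left. This is the homogeneity that \<open>quadratic_scalar_bound\<close> asks for.\<close>

lemma frame_sum_act:
  assumes \<omega>: "weight \<omega>" and sum: "\<And>x. summable (frame_term \<omega> x)"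
  shows "suminf (frame_term \<omega> (act a x)) = a * suminf (frame_term \<omega> x) * star a"
proof -
  have "frame_term \<omega> (act a x) n = a * frame_term \<omega> x n * star a" for n
  proof -
    have "\<omega> n * c = c * \<omega> n" for c
      using \<omega> by (simp add: weight_def central_def)
    then have c: "(\<omega> n)\<^sup>2 * a = a * (\<omega> n)\<^sup>2"
      by (metis mult.assoc power2_eq_square)
    show ?thesis
      using c unfolding frame_term_def orth_projection_act[OF complemented] ip_act_act
      by (metis mult.assoc)
  qed
  then have "frame_term \<omega> (act a x) = (\<lambda>n. a * frame_term \<omega> x n * star a)"
    by auto
  then show ?thesis
    by (simp add: suminf_mult suminf_mult2[symmetric] sum summable_mult)
qed

lemma frame_sum_scalar_bound:
  assumes \<omega>: "weight \<omega>" and frame: "star_fusion_frame act ip K \<omega>"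
  obtains k where "0 \<le> k" "\<And>x. norm_positive (k *\<^sub>R ip x x - suminf (frame_term \<omega> x))"
proof -
  obtain B where "\<And>x. norm_positive (B * ip x x * star B - suminf (frame_term \<omega> x))"
    using frame by (auto simp: star_fusion_frame_iff)
  then have "norm_positive ((norm B * norm B) *\<^sub>R ip x x - suminf (frame_term \<omega> x))" for x
    using frame by (intro quadratic_scalar_bound frame_sum_act[OF \<omega>]) (auto simp: star_fusion_frame_iff)
  then show ?thesis
    using that[of "norm B * norm B"] by simp
qed

lemma frame_weights_add:
  assumes \<alpha>: "\<alpha> \<in> frame_weights act ip K" and \<beta>: "\<beta> \<in> frame_weights act ip K"
  shows "(\<lambda>n. \<alpha> n + \<beta> n) \<in> frame_weights act ip K"
proof -
  let ?s = "\<lambda>n. \<alpha> n + \<beta> n"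
  have w: "weight \<alpha>" "weight \<beta>" and fr: "star_fusion_frame act ip K \<alpha>" "star_fusion_frame act ip K \<beta>"
    using \<alpha> \<beta> by (auto simp: frame_weights_def)
  have sum: "summable (frame_term \<alpha> x)" "summable (frame_term \<beta> x)" for x
    using fr by (auto simp: star_fusion_frame_iff)
  have cen: "central (\<alpha> n)" "central (\<beta> n)" and pos: "norm_positive (\<alpha> n)" "norm_positive (\<beta> n)" for n
    using w by (auto simp: weight_def strictly_positive_imp_norm_positive)
  have low: "norm_positive (frame_term ?s x n - frame_term \<alpha> x n)" for x n
    unfolding frame_term_def by (intro weight_square_sum_bounds cen pos ip_norm_positive)
  have up: "norm_positive (2 *\<^sub>R frame_term \<alpha> x n + 2 *\<^sub>R frame_term \<beta> x n - frame_term ?s x n)" for x n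
    unfolding frame_term_def by (intro weight_square_sum_bounds cen pos ip_norm_positive)
  have pos_term: "norm_positive (frame_term \<alpha> x n)" for x n
    unfolding frame_term_def power2_eq_square mult.assoc
    by (intro central_norm_positive_mult cen pos ip_norm_positive)
  have pos_sum: "norm_positive (frame_term ?s x n)" for x n
    using norm_positive_add[OF pos_term[of x n] low[of x n]] by simp
  have sum2: "summable (\<lambda>n. 2 *\<^sub>R frame_term \<alpha> x n + 2 *\<^sub>R frame_term \<beta> x n)" for x
    by (intro summable_add summable_scaleR_right sum)
  have ssum: "summable (frame_term ?s x)" for x
    by (rule norm_positive_summable_comparison[OF sum2 pos_sum up])
  obtain A where A: "strictly_positive A"
    "\<And>x. norm_positive (suminf (frame_term \<alpha> x) - A * ip x x * star A)"
    using fr(1) by (auto simp: star_fusion_frame_iff)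
  have lower: "norm_positive (suminf (frame_term ?s x) - A * ip x x * star A)" for x
    using norm_positive_add[OF A(2)[of x] norm_positive_suminf_le[OF sum(1)[of x] ssum[of x] low[of x]]]
    by simp
  obtain k where k: "0 \<le> k" "\<And>x. norm_positive (k *\<^sub>R ip x x - suminf (frame_term \<alpha> x))"
    using frame_sum_scalar_bound[OF w(1) fr(1)] by metis
  obtain l where l: "0 \<le> l" "\<And>x. norm_positive (l *\<^sub>R ip x x - suminf (frame_term \<beta> x))"
    using frame_sum_scalar_bound[OF w(2) fr(2)] by metis
  \<comment> \<open>The factors 2 come from \<open>up\<close>, and \<open>k\<close> and
    \<open>l\<close> from the two scalar bounds; the summand 1 keeps \<open>c\<close> positive when
    both vanish. The root is taken because the bound enters squared.\<close>
  define c where "c = sqrt (2 * k + 2 * l + 1)"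
  have c: "0 < c" "c * c = 2 * k + 2 * l + 1"
    using k(1) l(1) by (auto simp: c_def)
  have upper: "norm_positive ((c *\<^sub>R 1) * ip x x * star (c *\<^sub>R 1) - suminf (frame_term ?s x))" for x
  proof -
    let ?a = "suminf (frame_term \<alpha> x)" and ?b = "suminf (frame_term \<beta> x)"
    have "(\<Sum>n. 2 *\<^sub>R frame_term \<alpha> x n + 2 *\<^sub>R frame_term \<beta> x n) = 2 *\<^sub>R ?a + 2 *\<^sub>R ?b"
      by (simp add: suminf_add[symmetric] suminf_scaleR_right[symmetric] summable_scaleR_right sum)
    then have "norm_positive (2 *\<^sub>R ?a + 2 *\<^sub>R ?b - suminf (frame_term ?s x))"
      using norm_positive_suminf_le[OF ssum[of x] sum2[of x] up[of x]] by simp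
    \<comment> \<open>The isolated \<open>ip x x\<close> accounts for the summand 1 in
      \<open>c * c\<close>.\<close>
    then have "norm_positive (2 *\<^sub>R (k *\<^sub>R ip x x - ?a) + 2 *\<^sub>R (l *\<^sub>R ip x x - ?b) + ip x x
        + (2 *\<^sub>R ?a + 2 *\<^sub>R ?b - suminf (frame_term ?s x)))"
      by (intro norm_positive_add norm_positive_scaleR k(2) l(2) ip_norm_positive) simp_all
    moreover have "(c *\<^sub>R 1) * ip x x * star (c *\<^sub>R 1) = (2 * k + 2 * l + 1) *\<^sub>R ip x x"
      by (simp add: star_scaleR c(2))
    ultimately show ?thesis
      by (simp add: algebra_simps)
  qed
  have "strictly_positive (c *\<^sub>R (1::'a))"
    by (intro strictly_positive_scaleR strictly_positive_one c(1))
  then have "star_fusion_frame act ip K ?s"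
    unfolding star_fusion_frame_iff using ssum A(1) lower upper by blast
  then show ?thesis
    using weight_add[OF w] by (simp add: frame_weights_def)
qed

lemma frame_weights_scaleR:
  assumes \<alpha>: "\<alpha> \<in> frame_weights act ip K" and r: "0 < r"
  shows "(\<lambda>n. r *\<^sub>R \<alpha> n) \<in> frame_weights act ip K"
proof -
  let ?s = "\<lambda>n. r *\<^sub>R \<alpha> n"
  have w: "weight \<alpha>" and fr: "star_fusion_frame act ip K \<alpha>"
    using \<alpha> by (auto simp: frame_weights_def)
  have sum: "summable (frame_term \<alpha> x)" for x
    using fr by (auto simp: star_fusion_frame_iff)
  have "frame_term ?s x = (\<lambda>n. (r * r) *\<^sub>R frame_term \<alpha> x n)" for x
    by (auto simp: frame_term_def power2_eq_square)
  then have ssum: "summable (frame_term ?s x)"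
    and val: "suminf (frame_term ?s x) = (r * r) *\<^sub>R suminf (frame_term \<alpha> x)" for x
    using sum by (simp_all add: summable_scaleR_right suminf_scaleR_right)
  obtain A B where AB: "strictly_positive A" "strictly_positive B"
    "\<And>x. norm_positive (suminf (frame_term \<alpha> x) - A * ip x x * star A)"
    "\<And>x. norm_positive (B * ip x x * star B - suminf (frame_term \<alpha> x))"
    using fr by (auto simp: star_fusion_frame_iff)
  have "norm_positive ((r * r) *\<^sub>R (suminf (frame_term \<alpha> x) - A * ip x x * star A))"
    "norm_positive ((r * r) *\<^sub>R (B * ip x x * star B - suminf (frame_term \<alpha> x)))" for x
    by (intro norm_positive_scaleR AB; simp)+
  then have "norm_positive (suminf (frame_term ?s x) - (r *\<^sub>R A) * ip x x * star (r *\<^sub>R A))"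
    "norm_positive ((r *\<^sub>R B) * ip x x * star (r *\<^sub>R B) - suminf (frame_term ?s x))" for x
    by (simp_all add: val scaleR_diff_right star_scaleR)
  moreover have "strictly_positive (r *\<^sub>R A)" "strictly_positive (r *\<^sub>R B)"
    using AB r by (auto intro: strictly_positive_scaleR)
  ultimately have "star_fusion_frame act ip K ?s"
    unfolding star_fusion_frame_iff using ssum by blast
  then show ?thesis
    using weight_scaleR[OF w r] by (simp add: frame_weights_def)
qed

end

lemma vector_space_seq_scaleC:
  "vector_space (seq_scaleC :: complex \<Rightarrow> (nat \<Rightarrow> 'a::unital_cstar_algebra) \<Rightarrow> _)"
  by standard
    (simp_all add: seq_scaleC_def fun_eq_iff scaleC_add_right scaleC_add_left scaleC_scaleC scaleC_one)

theorem theorem3p8: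
  fixes act :: "'a::unital_cstar_algebra \<Rightarrow> 'h::banach \<Rightarrow> 'h"
    and ip :: "'h \<Rightarrow> 'h \<Rightarrow> 'a"
    and K :: "nat \<Rightarrow> 'h set"
  assumes "hilbert_module act ip"
    and "\<And>n. orthogonally_complemented act ip (K n)"
  shows "(\<forall>\<alpha>\<in>frame_weights act ip K. \<forall>\<beta>\<in>frame_weights act ip K.
            (\<lambda>n. \<alpha> n + \<beta> n) \<in> frame_weights act ip K) \<and>
         (frame_weights act ip K \<noteq> {} \<longrightarrow>
            complex_convex_cone seq_scaleC (frame_weights act ip K))"
proof -
  interpret complemented_sequence act ip K
    using assms by (simp add: complemented_sequence_def complemented_sequence_axioms_def)
  show ?thesis
    using frame_weights_add frame_weights_scaleR
    by (auto simp: complex_convex_cone_def vector_space_seq_scaleC plus_fun_def seq_scaleC_def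
        simp flip: scaleR_scaleC)
qed

end
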